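(* Let $M\in M_n(\mathbb R)$ be LCP-generic and such that $1\notin\mathrm{Spec}^a_L(M)$. Then the degree of $G_M$ is well-defined and it satisfies $$\deg G_M\equiv 1+c^a_L(M)\pmod 2,$$ where $c^a_L(M)$ is the number of LCP-aligned values of $M$ greater than one, counted with multiplicity. Moreover, $\deg G_M=\operatorname{sign}(\det(M+\mathbb I))$ if $c^a_L(M)=0$, and $\deg G_M=0$ if all LCP-aligned values of $M$ are larger than $1$.
   Context: $M_n(\mathbb R)$ is the space of real $n\times n$ matrices, $\mathbb I$ is the identity matrix, and $|\cdot|$ denotes the componentwise absolute value. $\mathcal S_n$ is the set of diagonal $n\times n$ matrices with all diagonal entries in $\{-1,+1\}$. For $M\in M_n(\mathbb R)$ let $G_M:\mathbb R^n\to\mathbb R^n$, $G_M(z)=\tfrac12(M+\mathbb I)z-\tfrac12(M-\mathbb I)|z|$. An LCP-aligned trio of $M$ is a triple $(\lambda,S,v)$ with $\lambda\ge0$ real, $S\in\mathcal S_n$, $v\in\mathbb R^n_{\ge0}$, $\|v\|_2=1$, and $(M-\mathbb I)v=\lambda(M+\mathbb I)Sv$. Then $\lambda$ is an LCP-aligned value of $M$, and $\mathrm{Spec}^a_L(M)$ is the set of LCP-aligned values of $M$. The multiplicity of an LCP-aligned value $\lambda$ of an LCP-generic $M$ is the number of pairs $(S,v)$ such that $(\lambda,S,v)$ is an LCP-aligned trio of $M$. A matrix $A\in M_n(\mathbb R)$ is generic if for every triple $(\lambda,S,v)$ with $\lambda\ge 0$, $S\in\mathcal S_n$, $v\in\mathbb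 R^n_{\ge 0}$, $\|v\|_2=1$ and $SAv=\lambda v$, $\lambda$ is a simple eigenvalue of $SA$ and $v$ is strictly positive. $M$ is LCP-generic if $M+\mathbb I$ is invertible and $(M+\mathbb I)^{-1}(M-\mathbb I)$ is generic. If $G_M(z)=0$ only for $z=0$ ($G_M$ nondegenerate), $\deg G_M$ is the topological degree of $\bar G_M:\mathbb S^{n-1}\to\mathbb S^{n-1}$, $x\mapsto G_M(x)/\|G_M(x)\|_2$ (defined via reduced homology if $n=1$). "The degree is well-defined" means that $G_M$ is nondegenerate. *)

theory Defs
  imports
    "HOL-Homology.Homology"
    "HOL-Number_Theory.Cong"
    "Jordan_Normal_Form.Char_Poly"
begin

(* Both HOL-Analysis and Jordan_Normal_Form provide vectors and matrices.  The dimension n is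
   a natural number here, so the Jordan_Normal_Form ones are used throughout. *)
unbundle no vec_syntax

definition vnorm2 :: "real vec \<Rightarrow> real" where
  "vnorm2 v = sqrt (\<Sum>i<dim_vec v. (v $ i)\<^sup>2)"

definition unit_nonneg_vecs :: "nat \<Rightarrow> real vec set" where
  "unit_nonneg_vecs n = {v \<in> carrier_vec n. (\<forall>i<n. 0 \<le> v $ i) \<and> vnorm2 v = 1}"

definition signature_mats :: "nat \<Rightarrow> real mat set" where
  "signature_mats n = {S \<in> carrier_mat n n. diagonal_mat S \<and> (\<forall>i<n. S $$ (i, i) \<in> {-1, 1})}"

definition G_map :: "nat \<Rightarrow> real mat \<Rightarrow> real vec \<Rightarrow> real vec" where
  "G_map n M z = (1/2) \<cdot>\<^sub>v ((M + 1\<^sub>m n) *\<^sub>v z) - (1/2) \<cdot>\<^sub>v ((M - 1\<^sub>m n) *\<^sub>v map_vec abs z)"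

definition lcp_aligned_trios :: "nat \<Rightarrow> real mat \<Rightarrow> (real \<times> real mat \<times> real vec) set" where
  "lcp_aligned_trios n M =
     {(l, S, v). 0 \<le> l \<and> S \<in> signature_mats n \<and> v \<in> unit_nonneg_vecs n \<and>
        (M - 1\<^sub>m n) *\<^sub>v v = l \<cdot>\<^sub>v ((M + 1\<^sub>m n) *\<^sub>v (S *\<^sub>v v))}"

definition lcp_aligned_spec :: "nat \<Rightarrow> real mat \<Rightarrow> real set" where
  "lcp_aligned_spec n M = {l. \<exists>S v. (l, S, v) \<in> lcp_aligned_trios n M}"

definition lcp_aligned_mult :: "nat \<Rightarrow> real mat \<Rightarrow> real \<Rightarrow> nat" where
  "lcp_aligned_mult n M l = card {(S, v). (l, S, v) \<in> lcp_aligned_trios n M}"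

(* If M is LCP-generic, the index set of the sum and all multiplicities are finite: there are
   finitely many S, finitely many eigenvalues of S A with A = (M + 1)^-1 (M - 1), and each
   aligned eigenvalue is simple.  So neither sum nor card takes its default value 0. *)
definition lcp_aligned_count :: "nat \<Rightarrow> real mat \<Rightarrow> nat" where
  "lcp_aligned_count n M = (\<Sum>l\<in>{l \<in> lcp_aligned_spec n M. 1 < l}. lcp_aligned_mult n M l)"

(* Simple means of algebraic multiplicity one. *)
definition simple_eigenvalue :: "real mat \<Rightarrow> real \<Rightarrow> bool" where
  "simple_eigenvalue A l \<longleftrightarrow> eigenvalue A l \<and> Polynomial.order l (char_poly A) = 1"

definition generic_mat :: "nat \<Rightarrow> real mat \<Rightarrow> bool" where
  "generic_mat n A \<longleftrightarrow>
     (\<forall>l S v. 0 \<le> l \<and> S \<in> signature_mats n \<and> v \<in> unit_nonneg_vecs n \<and>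
        (S * A) *\<^sub>v v = l \<cdot>\<^sub>v v \<longrightarrow>
        simple_eigenvalue (S * A) l \<and> (\<forall>i<n. 0 < v $ i))"

(* N is the (unique) inverse of M + 1. *)
definition lcp_generic :: "nat \<Rightarrow> real mat \<Rightarrow> bool" where
  "lcp_generic n M \<longleftrightarrow>
     (\<exists>N \<in> carrier_mat n n. inverts_mat (M + 1\<^sub>m n) N \<and> inverts_mat N (M + 1\<^sub>m n) \<and>
        generic_mat n (N * (M - 1\<^sub>m n)))"

definition G_nondegenerate :: "nat \<Rightarrow> real mat \<Rightarrow> bool" where
  "G_nondegenerate n M \<longleftrightarrow> (\<forall>z \<in> carrier_vec n. G_map n M z = 0\<^sub>v n \<longrightarrow> z = 0\<^sub>v n)"

(* The library realises R^n as the functions nat => real vanishing from n on, and the unit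
   sphere of R^(p+1) as nsphere p. *)
definition fun_of_vec :: "real vec \<Rightarrow> nat \<Rightarrow> real" where
  "fun_of_vec v = (\<lambda>i. if i < dim_vec v then v $ i else 0)"

definition G_sphere :: "nat \<Rightarrow> real mat \<Rightarrow> (nat \<Rightarrow> real) \<Rightarrow> nat \<Rightarrow> real" where
  "G_sphere n M x = (let w = G_map n M (vec n x) in fun_of_vec ((1 / vnorm2 w) \<cdot>\<^sub>v w))"

(* Meaningful for n \<ge> 1 and nondegenerate G_map n M.  Brouwer_degree2 is defined via reduced
   homology in every dimension, which covers the two-point sphere (n = 1). *)
definition deg_G :: "nat \<Rightarrow> real mat \<Rightarrow> int" where
  "deg_G n M = Brouwer_degree2 (n - 1) (G_sphere n M)"

end

theory Submission
  imports Defs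
begin

text \<open>
  Write \<open>A = (M + 1)\<^sup>-\<^sup>1 (M - 1)\<close>.  Up to the factor \<open>sgn (det (M + 1))\<close>, the degree of \<open>G_M\<close> is the
  degree \<open>d 1\<close>, where \<open>d x\<close> belongs to the piecewise linear map \<open>z \<mapsto> x z - A \<bar>z\<bar>\<close>.  This map
  degenerates exactly when \<open>x\<close> is an aligned value, it is homotopic to the identity for large \<open>x\<close>,
  and for \<open>x = 0\<close> it is even in each coordinate, so its degree is 0.

  A map that is linear on every orthant is given by the images of the vectors \<open>\<plusminus>e\<^sub>j\<close>.  Cutting the
  sphere into two hemispheres shows that its degree is additive in the pair of images of \<open>\<plusminus>e\<^sub>j\<close>:
  \<open>deg (a, c) = deg (a, b) + deg (b, c)\<close>.  Using this with \<open>b = - y\<close> in every coordinate expands the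
  degree modulo 2 into the number of orthants whose image cone contains the generic vector \<open>y\<close>.
  By Cramer's rule the preimage \<open>v\<close> of \<open>y\<close> in the orthant with signs \<open>S\<close> is a rational function of \<open>x\<close>
  with denominator \<open>det (x - S A)\<close>.  When \<open>x\<close> passes an aligned value, \<open>v\<close> passes through infinity
  in the direction of the aligned vector and changes sign once for every trio, so the count changes
  by the multiplicity modulo 2.
\<close>

section \<open>Additivity of the Brouwer degree over hemispheres\<close>

text \<open>The preimage count is obtained from homotopy invariance, multiplicativity and additivity
  of the degree. The expansion would carry a sign for every orthant; as only parity is wanted, these
  signs are not tracked. For the crossing argument \<open>y\<close> has to avoid not only the facet
  hyperplanes but also the range of every singular matrix at the crossed value, since otherwise the
  preimage need not have a pole there. Strict positivity of aligned vectors makes all coordinates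
  change sign together, and simplicity makes the pole simple, so that they do change. At an
  eigenvalue of \<open>S A\<close> without aligned vector the coordinates near the pole have both
  signs, and no preimage enters or leaves the orthant. Different signatures may be aligned at the
  same value and are counted separately.\<close>

definition reflect :: "nat \<Rightarrow> (nat \<Rightarrow> real) \<Rightarrow> nat \<Rightarrow> real" where
  "reflect k x = (\<lambda>i. if i = k then - x i else x i)"

lemma continuous_map_reflect: "continuous_map (nsphere p) (nsphere p) (reflect k)"
  using continuous_map_nsphere_reflection[of p k] unfolding reflect_def by simp

lemma reflect_at [simp]: "reflect k x k = - x k" "i \<noteq> k \<Longrightarrow> reflect k x i = x i"
  by (auto simp: reflect_def)

text \<open>
  A chain \<open>u\<close> that represents a nonzero relative class of the hemisphere has its boundary in the
  equator, which the reflection fixes; so \<open>u\<close> minus its mirror image is a cycle.  Relative to the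
  other hemisphere it is \<open>u\<close> again, which is nonzero by excision.
\<close>

lemma nontrivial_hemisphere_class:
  assumes "k \<le> p"
  obtains u where "singular_chain p (subtopology (nsphere p) {x. x k \<ge> 0}) u"
    and "singular_relcycle p (nsphere p) {} (u - chain_map p (reflect k) u)"
    and "homologous_rel_set p (nsphere p) {} (u - chain_map p (reflect k) u)
           \<in> carrier (reduced_homology_group (int p) (nsphere p))"
    and "homologous_rel_set p (nsphere p) {} (u - chain_map p (reflect k) u)
           \<noteq> \<one>\<^bsub>reduced_homology_group (int p) (nsphere p)\<^esub>"
proof -
  let ?S = "nsphere p" and ?r = "reflect k"
  let ?U = "subtopology ?S {x. x k \<ge> 0}" and ?L = "{x::nat\<Rightarrow>real. x k \<le> 0}"
    and ?E = "{x::nat\<Rightarrow>real. x k = 0}"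
  let ?R = "reduced_homology_group (int p) ?S"
  let ?H = "relative_homology_group (int p) ?S ?L" and ?G = "relative_homology_group (int p) ?U ?E"
  let ?i = "hom_induced (int p) ?U ?E ?S ?L id"
  have i: "?i \<in> iso ?G ?H"
    by (rule iso_relative_homology_group_upper_hemisphere)
  have "hom_induced (int p) ?S {} ?S ?L id \<in> iso ?R ?H"
    using iso_reduced_homology_group_lower_hemisphere[OF assms] by simp
  then have "\<not> trivial_group ?H"
    using trivial_reduced_homology_group_nsphere[of "int p" p] isomorphic_group_triviality
    by (metis group_reduced_homology_group group_relative_homology_group is_isoI)
  then have "\<not> trivial_group ?G"
    using i isomorphic_group_triviality by (metis group_relative_homology_group is_isoI)
  then have "carrier ?G \<noteq> {\<one>\<^bsub>?G\<^esub>}"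
    by (simp add: trivial_group_def)
  moreover have "\<one>\<^bsub>?G\<^esub> \<in> carrier ?G"
    by (meson group.is_monoid group_relative_homology_group monoid.one_closed)
  ultimately obtain g where g: "g \<in> carrier ?G" "g \<noteq> \<one>\<^bsub>?G\<^esub>"
    by blast
  then obtain u where u: "singular_relcycle p ?U ?E u" "g = homologous_rel_set p ?U ?E u"
    by (auto simp: carrier_relative_homology_group)
  have uch: "singular_chain p ?U u"
    using u(1) by (simp add: singular_relcycle)
  have uS: "singular_chain p ?S u"
    using uch by (simp add: singular_chain_subtopology)
  have rS: "singular_chain p ?S (chain_map p ?r u)"
    using uS continuous_map_reflect by (rule singular_chain_chain_map)
  have "chain_boundary p (chain_map p ?r u) = chain_map (p - Suc 0) ?r (chain_boundary p u)"
    by (rule chain_boundary_chain_map[OF uS])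
  also have "\<dots> = chain_boundary p u"
  proof (rule chain_map_id_gen)
    show "singular_chain (p - Suc 0) (subtopology ?U ?E) (chain_boundary p u)"
      using u(1) by (simp add: singular_relcycle)
    show "\<And>x. x \<in> topspace (subtopology ?U ?E) \<Longrightarrow> ?r x = x"
      by (auto simp: reflect_def)
  qed
  finally have cyc: "singular_relcycle p ?S {} (u - chain_map p ?r u)"
    using uS rS by (simp add: singular_cycle singular_chain_diff chain_boundary_diff)
  let ?c = "homologous_rel_set p ?S {} (u - chain_map p ?r u)"
  let ?D = "discrete_topology {()}"
  have chom: "?c \<in> carrier (homology_group (int p) ?S)"
    using cyc by (auto simp: carrier_relative_homology_group)
  have "hom_induced (int p) ?S {} ?D {} (\<lambda>x. ()) ?c
      = homologous_rel_set p ?D {} (chain_map p (\<lambda>x. ()) (u - chain_map p ?r u))"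
    by (rule hom_induced_chain_map) (use cyc in auto)
  also have "chain_map p (\<lambda>x. ()) (u - chain_map p ?r u) = 0"
  proof -
    have "chain_map p ((\<lambda>x. ()) \<circ> ?r) u = chain_map p (\<lambda>x. ()) u"
      by (rule chain_map_eq[OF uS]) simp
    then show ?thesis
      unfolding chain_map_compose o_apply chain_map_diff by simp
  qed
  also have "homologous_rel_set p ?D {} 0 = \<one>\<^bsub>homology_group (int p) ?D\<^esub>"
    by (simp add: homologous_rel_set_eq_relboundary)
  finally have cR: "?c \<in> carrier ?R"
    using chom by (simp add: carrier_reduced_homology_group kernel_def)
  have "?c \<noteq> \<one>\<^bsub>?R\<^esub>"
  proof
    assume "?c = \<one>\<^bsub>?R\<^esub>"
    then have b: "singular_relboundary p ?S {} (u - chain_map p ?r u)"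
      by (simp add: one_reduced_homology_group homologous_rel_set_eq_relboundary)
    have "singular_relboundary p ?S ?L (chain_map p id (u - chain_map p ?r u))"
      by (rule singular_relboundary_chain_map[OF b]) auto
    then have b': "singular_relboundary p ?S ?L (u - chain_map p ?r u)"
      using chain_map_ident[OF singular_chain_diff[OF uS rS]] by simp
    have "continuous_map ?U (subtopology ?S ?L) ?r"
      using continuous_map_reflect[of p k]
      by (auto simp: continuous_map_in_subtopology continuous_map_from_subtopology)
    then have "singular_chain p (subtopology ?S ?L) (chain_map p ?r u)"
      by (rule singular_chain_chain_map[OF uch])
    then have "singular_relboundary p ?S ?L (chain_map p ?r u)"
      by (rule singular_chain_imp_relboundary)
    then have "singular_relboundary p ?S ?L u"
      using singular_relboundary_add[OF b'] by fastforce
    moreover have "?i g = homologous_rel_set p ?S ?L (chain_map p id u)"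
      unfolding u(2)
      by (rule hom_induced_chain_map) (use u(1) in \<open>auto simp: continuous_map_from_subtopology\<close>)
    ultimately have "?i g = \<one>\<^bsub>?H\<^esub>"
      by (simp add: chain_map_ident[OF uS] homologous_rel_set_eq_relboundary)
    moreover have "?i \<in> mon ?G ?H"
      using i by (simp add: iso_iff_mon_epi)
    ultimately show False
      using g by (metis group_relative_homology_group mon_iff_hom_one)
  qed
  with uch cyc cR show thesis
    by (rule that)
qed

lemma homology_class_add:
  shows "homologous_rel_set p X S a \<otimes>\<^bsub>relative_homology_group (int p) X S\<^esub> homologous_rel_set p X S b
    = homologous_rel_set p X S (a + b)"
proof -
  have "\<exists>u v. homologous_rel p X S a u \<and> homologous_rel p X S b v \<and> x = u + v"
    if "homologous_rel p X S (a + b) x" for x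
    using that by (metis (no_types, lifting) diff_add_cancel diff_diff_eq2 homologous_rel_def homologous_rel_refl)
  moreover have "homologous_rel p X S (a + b) (u + v)"
    if "homologous_rel p X S a u" "homologous_rel p X S b v" for u v
    using that by (rule homologous_rel_add)
  ultimately show ?thesis
    unfolding mult_relative_homology_group by blast
qed

text \<open>On the cycle \<open>u - r u\<close>, with \<open>r\<close> the reflection, the maps
  \<open>f\<close>, \<open>g\<close>, \<open>h\<close> give \<open>f u - f r u\<close>,
  \<open>f r u - g r u\<close> and \<open>f u - g r u\<close>. The first two add up to the third.
  One nontrivial class determines the degree, as the homology group is infinite cyclic.\<close>

lemma Brouwer_degree2_additive:
  assumes k: "k \<le> p"
    and f: "continuous_map (nsphere p) (nsphere p) f"
    and g: "continuous_map (nsphere p) (nsphere p) g"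
    and h: "continuous_map (nsphere p) (nsphere p) h"
    and fh: "\<And>x. \<lbrakk>x \<in> topspace (nsphere p); x k \<ge> 0\<rbrakk> \<Longrightarrow> h x = f x"
    and fg: "\<And>x. \<lbrakk>x \<in> topspace (nsphere p); x k \<ge> 0\<rbrakk> \<Longrightarrow> g x = f (reflect k x)"
    and gh: "\<And>x. \<lbrakk>x \<in> topspace (nsphere p); x k \<le> 0\<rbrakk> \<Longrightarrow> h x = g x"
  shows "Brouwer_degree2 p h = Brouwer_degree2 p f + Brouwer_degree2 p g"
proof -
  let ?S = "nsphere p" and ?r = "reflect k"
  let ?U = "subtopology ?S {x. x k \<ge> 0}"
  let ?R = "reduced_homology_group (int p) ?S"
  obtain u where u: "singular_chain p ?U u" and cyc: "singular_relcycle p ?S {} (u - chain_map p ?r u)"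
    and cR: "homologous_rel_set p ?S {} (u - chain_map p ?r u) \<in> carrier ?R"
    and c1: "homologous_rel_set p ?S {} (u - chain_map p ?r u) \<noteq> \<one>\<^bsub>?R\<^esub>"
    using nontrivial_hemisphere_class[OF k] by blast
  let ?c = "homologous_rel_set p ?S {} (u - chain_map p ?r u)"
  have rU: "?r x \<in> topspace ?S" "?r x k \<le> 0" if "x \<in> topspace ?U" for x
    using that continuous_map_reflect[of p k] by (auto simp: continuous_map_def)
  have ch: "hom_induced (int p) ?S {} ?S {} e ?c
      = homologous_rel_set p ?S {} (chain_map p e u - chain_map p (e \<circ> ?r) u)"
    if "continuous_map ?S ?S e" for e
    using hom_induced_chain_map[OF that _ cyc]
    by (simp add: chain_map_diff chain_map_compose)
  have cyc': "singular_relcycle p ?S {} (chain_map p e u - chain_map p (e \<circ> ?r) u)"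
    if "continuous_map ?S ?S e" for e
    using singular_relcycle_chain_map[OF cyc that, of "{}"]
    by (simp add: chain_map_diff chain_map_compose)
  have 1: "chain_map p h u = chain_map p f u"
    by (rule chain_map_eq[OF u]) (auto simp: fh)
  have 2: "chain_map p g u = chain_map p (f \<circ> ?r) u"
    by (rule chain_map_eq[OF u]) (auto simp: fg)
  have 3: "chain_map p (h \<circ> ?r) u = chain_map p (g \<circ> ?r) u"
    by (rule chain_map_eq[OF u]) (use rU gh in auto)
  let ?hom = "\<lambda>e. hom_induced (int p) ?S {} ?S {} e ?c"
  have "?hom f \<otimes>\<^bsub>homology_group (int p) ?S\<^esub> ?hom g
      = homologous_rel_set p ?S {} ((chain_map p f u - chain_map p (f \<circ> ?r) u)
          + (chain_map p g u - chain_map p (g \<circ> ?r) u))"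
    unfolding ch[OF f] ch[OF g] 
    by (rule homology_class_add)
  also have "\<dots> = ?hom h"
    unfolding ch[OF h] 1 2 3 by simp
  finally have "?hom h = ?hom f \<otimes>\<^bsub>?R\<^esub> ?hom g"
    by (simp add: reduced_homology_group_def)
  also have "\<dots> = ?c [^]\<^bsub>?R\<^esub> (Brouwer_degree2 p f + Brouwer_degree2 p g)"
    unfolding Brouwer_degree2[OF cR] using cR by (simp add: group.int_pow_mult)
  finally show ?thesis
    using Brouwer_degree2_iff[OF h cR] c1 by blast
qed

section \<open>Maps that are linear on orthants\<close>

text \<open>\<open>P j\<close> and \<open>Q j\<close> are the images of \<open>e\<^sub>j\<close> and \<open>- e\<^sub>j\<close>.\<close>

definition plmap :: "nat \<Rightarrow> (nat \<Rightarrow> nat \<Rightarrow> real) \<Rightarrow> (nat \<Rightarrow> nat \<Rightarrow> real) \<Rightarrow> (nat \<Rightarrow> real) \<Rightarrow> nat \<Rightarrow> real" where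
  "plmap p P Q x i = (\<Sum>j\<le>p. max 0 (x j) * P j i + max 0 (- x j) * Q j i)"

definition normalize_to :: "nat \<Rightarrow> (nat \<Rightarrow> real) \<Rightarrow> nat \<Rightarrow> real" where
  "normalize_to p y = (\<lambda>i. if i \<le> p then y i / sqrt (\<Sum>k\<le>p. (y k)\<^sup>2) else 0)"

definition nondeg :: "nat \<Rightarrow> (nat \<Rightarrow> nat \<Rightarrow> real) \<Rightarrow> (nat \<Rightarrow> nat \<Rightarrow> real) \<Rightarrow> bool" where
  "nondeg p P Q \<longleftrightarrow> (\<forall>x. (\<forall>i\<le>p. plmap p P Q x i = 0) \<longrightarrow> (\<forall>i\<le>p. x i = 0))"

text \<open>Meaningful only under \<open>nondeg\<close>: otherwise division by zero makes the normalized map leave the sphere.\<close>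

definition pldeg :: "nat \<Rightarrow> (nat \<Rightarrow> nat \<Rightarrow> real) \<Rightarrow> (nat \<Rightarrow> nat \<Rightarrow> real) \<Rightarrow> int" where
  "pldeg p P Q = Brouwer_degree2 p (\<lambda>x. normalize_to p (plmap p P Q x))"

lemma sum_squares_pos_iff:
  fixes y :: "nat \<Rightarrow> real"
  shows "(\<Sum>k\<le>p. (y k)\<^sup>2) > 0 \<longleftrightarrow> (\<exists>i\<le>p. y i \<noteq> 0)"
proof -
  have "(\<Sum>k\<le>p. (y k)\<^sup>2) = 0 \<longleftrightarrow> (\<forall>i\<le>p. y i = 0)"
    by (auto simp: sum_nonneg_eq_0_iff)
  moreover have "(\<Sum>k\<le>p. (y k)\<^sup>2) \<ge> 0"
    by (simp add: sum_nonneg)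
  ultimately show ?thesis
    by (metis less_eq_real_def less_irrefl)
qed

lemma continuous_map_normalize_to:
  assumes "\<And>i. i \<le> p \<Longrightarrow> continuous_map X euclideanreal (\<lambda>x. F x i)"
    and "\<And>x. x \<in> topspace X \<Longrightarrow> \<exists>i\<le>p. F x i \<noteq> 0"
  shows "continuous_map X (nsphere p) (\<lambda>x. normalize_to p (F x))"
proof -
  have pos: "(\<Sum>k\<le>p. (F x k)\<^sup>2) > 0" if "x \<in> topspace X" for x
    using assms(2)[OF that] by (simp add: sum_squares_pos_iff)
  have "continuous_map X euclideanreal (\<lambda>x. normalize_to p (F x) i)" for i
  proof (cases "i \<le> p")
    case True
    have "continuous_map X euclideanreal (\<lambda>x. F x i / sqrt (\<Sum>k\<le>p. (F x k)\<^sup>2))"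
      using assms(1) True pos
      by (intro continuous_intros) (fastforce intro!: continuous_intros)+
    then show ?thesis
      using True by (simp add: normalize_to_def)
  qed (simp add: normalize_to_def)
  moreover have "(\<Sum>i\<le>p. (normalize_to p (F x) i)\<^sup>2) = 1" if "x \<in> topspace X" for x
  proof -
    have "(\<Sum>i\<le>p. (normalize_to p (F x) i)\<^sup>2) = (\<Sum>i\<le>p. (F x i)\<^sup>2 / (\<Sum>k\<le>p. (F x k)\<^sup>2))"
      using pos[OF that] by (intro sum.cong) (auto simp: normalize_to_def power_divide)
    then show ?thesis
      using pos[OF that] by (simp flip: sum_divide_distrib)
  qed
  ultimately show ?thesis
    unfolding nsphere continuous_map_in_subtopology continuous_map_componentwise_UNIV
    by (auto simp: normalize_to_def)
qed

lemma topspace_nsphere_nonzero: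
  assumes "x \<in> topspace (nsphere p)"
  shows "\<exists>i\<le>p. x i \<noteq> 0"
  using assms sum_squares_pos_iff[where y = x and p = p] by (auto simp: nsphere)

lemma nondegD:
  "\<lbrakk>nondeg p P Q; \<exists>i\<le>p. x i \<noteq> 0\<rbrakk> \<Longrightarrow> \<exists>i\<le>p. plmap p P Q x i \<noteq> 0"
  unfolding nondeg_def by blast

lemma continuous_map_plmap:
  assumes "nondeg p P Q"
  shows "continuous_map (nsphere p) (nsphere p) (\<lambda>x. normalize_to p (plmap p P Q x))"
proof (rule continuous_map_normalize_to)
  show "continuous_map (nsphere p) euclideanreal (\<lambda>x. plmap p P Q x i)" for i
    unfolding plmap_def by (intro continuous_intros continuous_map_nsphere_projection) auto
  show "\<exists>i\<le>p. plmap p P Q x i \<noteq> 0" if "x \<in> topspace (nsphere p)" for x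
    using nondegD[OF assms topspace_nsphere_nonzero[OF that]] .
qed

text \<open>\<open>plmap\<close> is linear in the pair of column families, so straight lines between
  columns give a straight-line homotopy of maps; nondegeneracy at each time allows it to be
  normalized.\<close>

lemma pldeg_homotopy:
  assumes "\<And>t. \<lbrakk>0 \<le> t; t \<le> 1\<rbrakk> \<Longrightarrow>
    nondeg p (\<lambda>j i. (1 - t) * P j i + t * P' j i) (\<lambda>j i. (1 - t) * Q j i + t * Q' j i)"
  shows "pldeg p P Q = pldeg p P' Q'"
proof -
  define F where "F = (\<lambda>y :: real \<times> (nat \<Rightarrow> real).
    plmap p (\<lambda>j i. (1 - fst y) * P j i + fst y * P' j i) (\<lambda>j i. (1 - fst y) * Q j i + fst y * Q' j i) (snd y))"
  let ?X = "prod_topology (top_of_set {0..1::real}) (nsphere p)"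
  have fst: "continuous_map ?X euclideanreal fst"
    using continuous_map_fst continuous_map_in_subtopology by fastforce
  have snd: "continuous_map ?X euclideanreal (\<lambda>y. snd y j)" for j
    using continuous_map_compose[OF continuous_map_snd continuous_map_nsphere_projection]
    by (simp add: o_def)
  have "continuous_map ?X (nsphere p) (\<lambda>y. normalize_to p (F y))"
  proof (rule continuous_map_normalize_to)
    show "continuous_map ?X euclideanreal (\<lambda>y. F y i)" for i
      unfolding F_def plmap_def by (intro continuous_intros fst snd) auto
    show "\<exists>i\<le>p. F y i \<noteq> 0" if "y \<in> topspace ?X" for y
      unfolding F_def using that assms[of "fst y"] topspace_nsphere_nonzero[of "snd y" p]
      by (intro nondegD) auto
  qed
  then have "homotopic_with (\<lambda>x. True) (nsphere p) (nsphere p)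
      (\<lambda>x. normalize_to p (plmap p P Q x)) (\<lambda>x. normalize_to p (plmap p P' Q' x))"
    unfolding homotopic_with_def
    by (intro exI[of _ "\<lambda>y. normalize_to p (F y)"]) (simp add: F_def)
  then show ?thesis
    unfolding pldeg_def by (rule Brouwer_degree2_homotopic)
qed

text \<open>Each coordinate uses only the column selected by its sign, so a hemisphere does not see
  the column of the opposite unit vector.\<close>

lemma plmap_cong:
  assumes "\<And>j. j \<le> p \<Longrightarrow> x j > 0 \<Longrightarrow> P j i = P' j i" "\<And>j. j \<le> p \<Longrightarrow> x j < 0 \<Longrightarrow> Q j i = Q' j i"
  shows "plmap p P Q x i = plmap p P' Q' x i"
  unfolding plmap_def
proof (rule sum.cong)
  fix j assume "j \<in> {..p}"
  then show "max 0 (x j) * P j i + max 0 (- x j) * Q j i = max 0 (x j) * P' j i + max 0 (- x j) * Q' j i"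
    using assms[of j] by (cases "x j" "0::real" rule: linorder_cases) auto
qed simp

lemma normalize_to_cong:
  assumes "\<And>i. i \<le> p \<Longrightarrow> y i = z i"
  shows "normalize_to p y = normalize_to p z"
  using assms by (auto simp: normalize_to_def)

lemma pldeg_cong:
  assumes "\<And>i j. \<lbrakk>i \<le> p; j \<le> p\<rbrakk> \<Longrightarrow> P j i = P' j i" "\<And>i j. \<lbrakk>i \<le> p; j \<le> p\<rbrakk> \<Longrightarrow> Q j i = Q' j i"
  shows "pldeg p P Q = pldeg p P' Q'"
  unfolding pldeg_def
  by (intro Brouwer_degree2_eq normalize_to_cong plmap_cong assms)

section \<open>The degree as a function of one pair of columns\<close>

lemma plmap_reflect:
  "plmap p P Q (reflect k x) = plmap p (P(k := Q k)) (Q(k := P k)) x"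
  unfolding plmap_def by (intro ext sum.cong) (auto simp: reflect_def)

lemma nondeg_swap:
  assumes "nondeg p P Q"
  shows "nondeg p (P(k := Q k)) (Q(k := P k))"
  unfolding nondeg_def
proof (intro allI impI)
  fix x i
  assume "\<forall>i\<le>p. plmap p (P(k := Q k)) (Q(k := P k)) x i = 0" "i \<le> p"
  then have "reflect k x i = 0"
    using assms by (auto simp: nondeg_def simp flip: plmap_reflect)
  then show "x i = 0"
    by (auto simp: reflect_def split: if_splits)
qed

text \<open>The half space \<open>x k \<ge> 0\<close> sees only \<open>a\<close> and the other one
  only \<open>c\<close>; the inner columns \<open>b\<close> and \<open>b'\<close> may
  differ.\<close>

lemma nondeg_mix:
  assumes "nondeg p (P(k := a)) (Q(k := b))" "nondeg p (P(k := b')) (Q(k := c))"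
  shows "nondeg p (P(k := a)) (Q(k := c))"
  unfolding nondeg_def
proof (intro allI impI)
  fix x i
  assume x: "\<forall>i\<le>p. plmap p (P(k := a)) (Q(k := c)) x i = 0" and i: "i \<le> p"
  show "x i = 0"
  proof (cases "x k \<ge> 0")
    case True
    have "plmap p (P(k := a)) (Q(k := c)) x i = plmap p (P(k := a)) (Q(k := b)) x i" for i
      by (rule plmap_cong) (use True in auto)
    then show ?thesis
      using x i assms(1) by (simp add: nondeg_def)
  next
    case False
    have "plmap p (P(k := a)) (Q(k := c)) x i = plmap p (P(k := b')) (Q(k := c)) x i" for i
      by (rule plmap_cong) (use False in auto)
    then show ?thesis
      using x i assms(2) by (simp add: nondeg_def)
  qed
qed

text \<open>The map for \<open>(a, c)\<close> is glued from those for \<open>(a, b)\<close> and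
  \<open>(b, c)\<close>. The common column \<open>b\<close> makes the latter the mirror image of the
  former on the upper hemisphere.\<close>

lemma pldeg_additive:
  assumes k: "k \<le> p"
    and ab: "nondeg p (P(k := a)) (Q(k := b))"
    and bc: "nondeg p (P(k := b)) (Q(k := c))"
  shows "pldeg p (P(k := a)) (Q(k := c)) = pldeg p (P(k := a)) (Q(k := b)) + pldeg p (P(k := b)) (Q(k := c))"
  unfolding pldeg_def
proof (rule Brouwer_degree2_additive[OF k])
  show "continuous_map (nsphere p) (nsphere p) (\<lambda>x. normalize_to p (plmap p (P(k := a)) (Q(k := b)) x))"
    using ab by (rule continuous_map_plmap)
  show "continuous_map (nsphere p) (nsphere p) (\<lambda>x. normalize_to p (plmap p (P(k := b)) (Q(k := c)) x))"
    using bc by (rule continuous_map_plmap)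
  show "continuous_map (nsphere p) (nsphere p) (\<lambda>x. normalize_to p (plmap p (P(k := a)) (Q(k := c)) x))"
    using nondeg_mix[OF ab bc] by (rule continuous_map_plmap)
next
  fix x :: "nat \<Rightarrow> real" assume "x k \<ge> 0"
  then show "normalize_to p (plmap p (P(k := a)) (Q(k := c)) x) = normalize_to p (plmap p (P(k := a)) (Q(k := b)) x)"
    by (intro normalize_to_cong plmap_cong) auto
next
  fix x :: "nat \<Rightarrow> real" assume "x k \<ge> 0"
  then show "normalize_to p (plmap p (P(k := b)) (Q(k := c)) x)
     = normalize_to p (plmap p (P(k := a)) (Q(k := b)) (reflect k x))"
    unfolding plmap_reflect by (intro normalize_to_cong plmap_cong) auto
next
  fix x :: "nat \<Rightarrow> real" assume "x k \<le> 0"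
  then show "normalize_to p (plmap p (P(k := a)) (Q(k := c)) x) = normalize_to p (plmap p (P(k := b)) (Q(k := c)) x)"
    by (intro normalize_to_cong plmap_cong) auto
qed

text \<open>Additivity with all three columns equal says that the degree is twice itself.\<close>

lemma pldeg_equal_columns:
  assumes "k \<le> p" "P k = Q k" "nondeg p P Q"
  shows "pldeg p P Q = 0"
proof -
  have "P(k := P k) = P" "Q(k := P k) = Q"
    using assms(2) by (auto simp: fun_upd_idem_iff)
  then show ?thesis
    using pldeg_additive[of k p P "P k" Q "P k" "P k"] assms by simp
qed

text \<open>The pairs \<open>(a, b)\<close> and \<open>(b, a)\<close> add up to
  \<open>(a, a)\<close>, whose degree is 0.\<close>

lemma pldeg_swap:
  assumes "k \<le> p" "nondeg p P Q"
  shows "pldeg p (P(k := Q k)) (Q(k := P k)) = - pldeg p P Q"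
proof -
  have nd: "nondeg p (P(k := Q k)) (Q(k := P k))"
    using assms(2) by (rule nondeg_swap)
  have "nondeg p (P(k := P k)) (Q(k := P k))"
    by (rule nondeg_mix[of p P k "P k" Q "Q k" "Q k"]) (use assms nd in auto)
  then have "pldeg p (P(k := P k)) (Q(k := P k)) = 0"
    using assms(1) by (intro pldeg_equal_columns[of k]) auto
  then show ?thesis
    using pldeg_additive[of k p P "P k" Q "Q k" "P k"] assms nd by simp
qed

section \<open>The degree of a linear isomorphism\<close>

text \<open>Stated over commutative rings because the adjugate is used both for real and for
  polynomial matrices.\<close>

lemma smult_one_mult_vec:
  fixes v :: "'a :: comm_ring_1 vec"
  assumes "v \<in> carrier_vec n"
  shows "(d \<cdot>\<^sub>m 1\<^sub>m n) *\<^sub>v v = d \<cdot>\<^sub>v v"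
  using assms by (intro eq_vecI)
    (auto simp: scalar_prod_def if_distrib[where f = "\<lambda>x. x * _"] if_distrib[where f = "\<lambda>x. _ * x"] cong: if_cong)

definition cmat :: "nat \<Rightarrow> (nat \<Rightarrow> nat \<Rightarrow> real) \<Rightarrow> real mat" where
  "cmat p C = mat (Suc p) (Suc p) (\<lambda>(i, j). C j i)"

lemma cmat_carrier [simp]: "cmat p C \<in> carrier_mat (Suc p) (Suc p)"
  by (simp add: cmat_def)

lemma cmat_mult_vec:
  assumes "i \<le> p"
  shows "(cmat p C *\<^sub>v vec (Suc p) x) $ i = (\<Sum>j\<le>p. x j * C j i)"
  using assms by (simp add: cmat_def scalar_prod_def atLeast0LessThan lessThan_Suc_atMost mult.commute)

lemma cmat_independent:
  assumes "det (cmat p C) \<noteq> 0" and x: "\<And>i. i \<le> p \<Longrightarrow> (\<Sum>j\<le>p. x j * C j i) = 0" and "j \<le> p"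
  shows "x j = 0"
proof -
  have "cmat p C *\<^sub>v vec (Suc p) x = 0\<^sub>v (Suc p)"
  proof (rule eq_vecI)
    fix i assume "i < dim_vec (0\<^sub>v (Suc p) :: real vec)"
    then show "(cmat p C *\<^sub>v vec (Suc p) x) $ i = 0\<^sub>v (Suc p) $ i"
      using cmat_mult_vec[of i p C x] x[of i] by simp
  qed (simp add: cmat_def)
  then have "vec (Suc p) x = 0\<^sub>v (Suc p)"
    using assms(1) det_0_iff_vec_prod_zero[OF cmat_carrier] by (metis vec_carrier)
  then show ?thesis
    using assms(3) by (metis index_vec index_zero_vec(1) le_imp_less_Suc)
qed

lemma cmat_span:
  assumes "det (cmat p C) \<noteq> 0"
  obtains w where "\<And>i. i \<le> p \<Longrightarrow> b i = (\<Sum>j\<le>p. w j * C j i)"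
proof -
  let ?A = "cmat p C" and ?b = "vec (Suc p) b"
  define v where "v = (1 / det ?A) \<cdot>\<^sub>v (adj_mat ?A *\<^sub>v ?b)"
  have adj: "adj_mat ?A \<in> carrier_mat (Suc p) (Suc p)" "?A * adj_mat ?A = det ?A \<cdot>\<^sub>m 1\<^sub>m (Suc p)"
    using adj_mat[OF cmat_carrier] by auto
  have v: "v \<in> carrier_vec (Suc p)"
    using adj by (simp add: v_def)
  have "?A *\<^sub>v v = (1 / det ?A) \<cdot>\<^sub>v (?A *\<^sub>v (adj_mat ?A *\<^sub>v ?b))"
    unfolding v_def by (rule mult_mat_vec[OF cmat_carrier mult_mat_vec_carrier[OF adj(1)]]) simp
  also have "?A *\<^sub>v (adj_mat ?A *\<^sub>v ?b) = (?A * adj_mat ?A) *\<^sub>v ?b"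
    by (rule assoc_mult_mat_vec[OF cmat_carrier adj(1), symmetric]) simp
  also have "\<dots> = det ?A \<cdot>\<^sub>v ?b"
    unfolding adj by (rule smult_one_mult_vec) simp
  finally have "?A *\<^sub>v v = ?b"
    using assms by (simp add: smult_smult_assoc)
  moreover have "v = vec (Suc p) (($) v)"
    using v by auto
  ultimately have "b i = (\<Sum>j\<le>p. v $ j * C j i)" if "i \<le> p" for i
    using cmat_mult_vec[OF that, of C "($) v"] that by simp
  then show thesis by (rule that)
qed

lemma cmat_det_upd:
  assumes k: "k \<le> p" and b: "\<And>i. i \<le> p \<Longrightarrow> b i = (\<Sum>j\<le>p. w j * C j i)"
  shows "det (cmat p (C(k := b))) = w k * det (cmat p C)"
proof -
  let ?A = "cmat p C" and ?w = "vec (Suc p) w"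
  have "replace_col ?A (?A *\<^sub>v ?w) k = cmat p (C(k := b))"
  proof (rule eq_matI)
    fix i j assume "i < dim_row (cmat p (C(k := b)))" "j < dim_col (cmat p (C(k := b)))"
    then have ij: "i \<le> p" "j \<le> p" by (auto simp: cmat_def)
    then show "replace_col ?A (?A *\<^sub>v ?w) k $$ (i, j) = cmat p (C(k := b)) $$ (i, j)"
      using cmat_mult_vec[of i p C w] b[of i] by (auto simp: replace_col_def cmat_def)
  qed (auto simp: replace_col_def cmat_def)
  then show ?thesis
    using cramer_lemma_mat[OF cmat_carrier, of ?w p k C] k by simp
qed

abbreviation lindeg :: "nat \<Rightarrow> (nat \<Rightarrow> nat \<Rightarrow> real) \<Rightarrow> int" where
  "lindeg p C \<equiv> pldeg p C (\<lambda>j i. - C j i)"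

lemma plmap_linear: "plmap p C (\<lambda>j i. - C j i) x i = (\<Sum>j\<le>p. x j * C j i)"
  unfolding plmap_def by (rule sum.cong) (auto simp: max_def)

lemma nondeg_linear:
  assumes "det (cmat p C) \<noteq> 0"
  shows "nondeg p C (\<lambda>j i. - C j i)"
  unfolding nondeg_def plmap_linear using cmat_independent[OF assms] by blast

text \<open>On the segment from \<open>C k\<close> to \<open>b\<close> the coefficient along
  \<open>C k\<close> is \<open>(1 - t) + t * w k\<close>, which stays positive, so by Cramer's rule
  the determinant never vanishes.\<close>

lemma lindeg_upd_pos:
  assumes k: "k \<le> p" and C: "det (cmat p C) \<noteq> 0"
    and b: "\<And>i. i \<le> p \<Longrightarrow> b i = (\<Sum>j\<le>p. w j * C j i)" and w: "w k > 0"
  shows "lindeg p (C(k := b)) = lindeg p C"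
proof (rule sym, rule pldeg_homotopy)
  fix t :: real assume t: "0 \<le> t" "t \<le> 1"
  let ?D = "\<lambda>j i. (1 - t) * C j i + t * (C(k := b)) j i"
  let ?w = "\<lambda>j. (if j = k then 1 - t else 0) + t * w j"
  define b' where "b' i = (1 - t) * C k i + t * b i" for i
  have "b' i = (\<Sum>j\<le>p. ?w j * C j i)" if "i \<le> p" for i
  proof -
    have "(\<Sum>j\<le>p. ?w j * C j i) = (\<Sum>j\<le>p. (if j = k then (1 - t) * C j i else 0) + t * (w j * C j i))"
      by (intro sum.cong) (auto simp: algebra_simps)
    also have "\<dots> = (\<Sum>j\<le>p. (if j = k then (1 - t) * C j i else 0)) + t * (\<Sum>j\<le>p. w j * C j i)"
      by (simp only: sum.distrib sum_distrib_left)
    finally have "(\<Sum>j\<le>p. ?w j * C j i) = (\<Sum>j\<le>p. (if j = k then (1 - t) * C j i else 0)) + t * (\<Sum>j\<le>p. w j * C j i)" .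
    then show ?thesis
      using k b[OF that] by (simp add: b'_def)
  qed
  then have "det (cmat p (C(k := b'))) = ?w k * det (cmat p C)"
    by (rule cmat_det_upd[OF k])
  moreover have "?w k > 0"
    using t w by (cases "t = 0") (auto simp: add_nonneg_pos)
  ultimately have "nondeg p (C(k := b')) (\<lambda>j i. - (C(k := b')) j i)"
    using C by (intro nondeg_linear) simp
  moreover have "C(k := b') = ?D"
    by (auto simp: b'_def fun_eq_iff algebra_simps)
  ultimately show "nondeg p ?D (\<lambda>j i. (1 - t) * - C j i + t * - (C(k := b)) j i)"
    by (simp add: algebra_simps)
qed

text \<open>For \<open>w k < 0\<close> the column \<open>- b\<close> falls under the positive case;
  exchanging the images of the two opposite unit vectors turns it into \<open>b\<close> at the cost
  of a sign.\<close>

lemma lindeg_upd: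
  assumes k: "k \<le> p" and C: "det (cmat p C) \<noteq> 0"
    and b: "\<And>i. i \<le> p \<Longrightarrow> b i = (\<Sum>j\<le>p. w j * C j i)" and w: "w k \<noteq> 0"
  shows "real_of_int (lindeg p (C(k := b))) = sgn (w k) * lindeg p C"
proof (cases "w k > 0")
  case True
  then show ?thesis
    using lindeg_upd_pos[OF k C b] by simp
next
  case False
  let ?C = "C(k := (\<lambda>i. - b i))"
  have b': "- b i = (\<Sum>j\<le>p. - w j * C j i)" if "i \<le> p" for i
    using b[OF that] by (simp add: sum_negf)
  have "lindeg p ?C = lindeg p C"
    by (rule lindeg_upd_pos[OF k C b']) (use False w in auto)
  moreover have "nondeg p ?C (\<lambda>j i. - ?C j i)"
    using cmat_det_upd[OF k b'] C w by (intro nondeg_linear) simp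
  then have "pldeg p (?C(k := (\<lambda>i. - ?C k i))) ((\<lambda>j i. - ?C j i)(k := ?C k)) = - lindeg p ?C"
    by (rule pldeg_swap[OF k])
  moreover have "?C(k := (\<lambda>i. - ?C k i)) = C(k := b)"
    "(\<lambda>j i. - ?C j i)(k := ?C k) = (\<lambda>j i. - (C(k := b)) j i)"
    by (auto simp: fun_eq_iff)
  ultimately show ?thesis
    using False w by simp
qed

lemma lindeg_id:
  assumes "\<And>i j. i \<le> p \<Longrightarrow> j \<le> p \<Longrightarrow> C j i = (if i = j then 1 else 0)"
  shows "lindeg p C = 1"
proof -
  have "plmap p C (\<lambda>j i. - C j i) x i = x i" if "i \<le> p" for x i
  proof -
    have "(\<Sum>j\<le>p. x j * C j i) = (\<Sum>j\<le>p. if j = i then x j else 0)"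
      using assms that by (intro sum.cong) auto
    then show ?thesis
      using that by (simp add: plmap_linear)
  qed
  then have "normalize_to p (plmap p C (\<lambda>j i. - C j i) x) = x" if "x \<in> topspace (nsphere p)" for x
    using that by (auto simp: normalize_to_def nsphere fun_eq_iff)
  then have "lindeg p C = Brouwer_degree2 p id"
    unfolding pldeg_def by (intro Brouwer_degree2_eq) simp
  then show ?thesis by simp
qed

text \<open>
  The columns are replaced by unit vectors one at a time.  If \<open>e\<^sub>k\<close> has no component along column
  \<open>k\<close>, then a column \<open>j > k\<close> along which it has one is first sheared by column \<open>k\<close>.
\<close>

lemma lindeg_eq_sgn_det_aux:
  assumes "m \<le> Suc p" "det (cmat p C) \<noteq> 0"
    and "\<And>i j. i \<le> p \<Longrightarrow> j < m \<Longrightarrow> C j i = (if i = j then 1 else 0)"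
  shows "real_of_int (lindeg p C) = sgn (det (cmat p C))"
  using assms
\<comment> \<open>The induction runs downwards: \<open>m\<close> leading columns are already unit
  vectors, and \<open>m = Suc p\<close> is the identity matrix.\<close>
proof (induction m arbitrary: C rule: inc_induct)
  case base
  then have "cmat p C = 1\<^sub>m (Suc p)"
    by (auto simp: cmat_def)
  then show ?case
    using lindeg_id[of p C] base by simp
next
  case (step k)
  then have k: "k \<le> p" by simp
  define e :: "nat \<Rightarrow> real" where "e = (\<lambda>i. if i = k then 1 else 0)"
  have replace: "real_of_int (lindeg p B) = sgn (det (cmat p B))"
    if B: "det (cmat p B) \<noteq> 0" "\<And>i j. i \<le> p \<Longrightarrow> j < k \<Longrightarrow> B j i = (if i = j then 1 else 0)"
      and w: "\<And>i. i \<le> p \<Longrightarrow> e i = (\<Sum>j\<le>p. w j * B j i)" "w k \<noteq> 0" for B w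
  proof -
    have d: "det (cmat p (B(k := e))) = w k * det (cmat p B)"
      by (rule cmat_det_upd[OF k w(1)])
    have "real_of_int (lindeg p (B(k := e))) = sgn (w k * det (cmat p B))"
      unfolding d[symmetric]
    proof (rule step.IH)
      show "det (cmat p (B(k := e))) \<noteq> 0"
        using B(1) w(2) by (simp add: d)
      show "(B(k := e)) j i = (if i = j then 1 else 0)" if "i \<le> p" "j < Suc k" for i j
        using B(2) that by (cases "j = k") (auto simp: e_def)
    qed
    then have "sgn (w k) * real_of_int (lindeg p B) = sgn (w k) * sgn (det (cmat p B))"
      using lindeg_upd[OF k B(1) w] unfolding sgn_mult by (rule trans[OF sym, rotated])
    moreover have "sgn (w k) \<noteq> 0"
      using w(2) by (simp add: sgn_0_0)
    ultimately show ?thesis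
      by (metis mult_left_cancel)
  qed
  obtain w where w: "\<And>i. i \<le> p \<Longrightarrow> e i = (\<Sum>j\<le>p. w j * C j i)"
    using cmat_span[OF step.prems(1)] by blast
  show ?case
  proof (cases "w k = 0")
    case False
    then show ?thesis
      using replace[OF step.prems] w by blast
  next
    case True
    \<comment> \<open>Columns before \<open>k\<close> are unit vectors with entry 0 in row
      \<open>k\<close>, and \<open>w k = 0\<close>; if all later coefficients vanished too, row
      \<open>k\<close> of the expansion of \<open>e\<close> would read 1 = 0.\<close>
    have "\<exists>j. k < j \<and> j \<le> p \<and> w j \<noteq> 0"
    proof (rule ccontr)
      assume "\<not> ?thesis"
      then have "w j * C j k = 0" if "j \<le> p" for j
        using that True step.prems(2)[OF k, of j] by (cases j k rule: linorder_cases) auto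
      then have "(\<Sum>j\<le>p. w j * C j k) = 0"
        by (intro sum.neutral) auto
      then show False
        using w[OF k] by (simp add: e_def)
    qed
    then obtain j where j: "k < j" "j \<le> p" "w j \<noteq> 0" by blast
    define v where "v = (\<lambda>i. if i = j then 1 else if i = k then -1 else 0 :: real)"
    define b where "b i = C j i - C k i" for i
    have "b i = (\<Sum>l\<le>p. v l * C l i)" for i
    proof -
      have "(\<Sum>l\<le>p. v l * C l i) = (\<Sum>l\<le>p. (if l = j then C l i else 0) - (if l = k then C l i else 0))"
        using j by (intro sum.cong) (auto simp: v_def)
      then show ?thesis
        using j k by (simp add: b_def sum_subtractf)
    qed
    note b = this
    have vj: "v j = 1" by (simp add: v_def)
    let ?B = "C(j := b)"
    have dB: "det (cmat p ?B) = det (cmat p C)"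
      using cmat_det_upd[OF j(2) b] vj by simp
    have lB: "lindeg p ?B = lindeg p C"
      using lindeg_upd_pos[OF j(2) step.prems(1) b] vj by simp
    \<comment> \<open>Substituting \<open>C j = b + C k\<close> into the expansion of
      \<open>e\<close> puts the coefficient \<open>w j\<close> on column \<open>k\<close>, whose own
      coefficient is 0.\<close>
    let ?w = "w(k := w j)"
    have "e i = (\<Sum>l\<le>p. ?w l * ?B l i)" if i: "i \<le> p" for i
    proof -
      have "(\<Sum>l\<le>p. ?w l * ?B l i)
          = (\<Sum>l\<le>p. w l * C l i + (if l = j then - w j * C k i else 0) + (if l = k then w j * C k i else 0))"
        using j True by (intro sum.cong) (auto simp: b_def algebra_simps)
      then show ?thesis
        using w[OF i] j k by (simp add: sum.distrib)
    qed
    then have eB: "\<And>i. i \<le> p \<Longrightarrow> e i = (\<Sum>l\<le>p. ?w l * ?B l i)" .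
    have "real_of_int (lindeg p ?B) = sgn (det (cmat p ?B))"
    proof (rule replace[OF _ _ eB])
      show "det (cmat p ?B) \<noteq> 0"
        unfolding dB by (rule step.prems(1))
      show "?B l i = (if i = l then 1 else 0)" if "i \<le> p" "l < k" for i l
        using step.prems(2)[OF that] that j by simp
    qed (use j in auto)
    then show ?thesis
      by (simp only: dB lB)
  qed
qed

theorem lindeg_eq_sgn_det:
  assumes "det (cmat p C) \<noteq> 0"
  shows "real_of_int (lindeg p C) = sgn (det (cmat p C))"
  using lindeg_eq_sgn_det_aux[of 0 p C] assms by simp

section \<open>Composition with a linear isomorphism\<close>

lemma plmap_linear_image:
  "plmap p (\<lambda>j i. \<Sum>k\<le>p. P j k * B k i) (\<lambda>j i. \<Sum>k\<le>p. Q j k * B k i) x i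
    = (\<Sum>k\<le>p. plmap p P Q x k * B k i)"
  unfolding plmap_def sum_distrib_right sum_distrib_left
  by (subst sum.swap) (simp add: sum_distrib_left algebra_simps flip: sum.distrib)

text \<open>Degrees multiply under composition. The normalization between the two maps cancels,
  because the outer map is homogeneous and is normalized again.\<close>

lemma pldeg_linear_image:
  assumes B: "det (cmat p B) \<noteq> 0" and PQ: "nondeg p P Q"
  shows "pldeg p (\<lambda>j i. \<Sum>k\<le>p. P j k * B k i) (\<lambda>j i. \<Sum>k\<le>p. Q j k * B k i) = lindeg p B * pldeg p P Q"
proof -
  let ?l = "\<lambda>x. normalize_to p (plmap p B (\<lambda>j i. - B j i) x)" and ?f = "\<lambda>x. normalize_to p (plmap p P Q x)"
  have "lindeg p B * pldeg p P Q = Brouwer_degree2 p (?l \<circ> ?f)"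
    unfolding pldeg_def
    by (rule Brouwer_degree2_compose[symmetric]; rule continuous_map_plmap)
      (use PQ nondeg_linear[OF B] in auto)
  also have "\<dots> = pldeg p (\<lambda>j i. \<Sum>k\<le>p. P j k * B k i) (\<lambda>j i. \<Sum>k\<le>p. Q j k * B k i)"
    unfolding pldeg_def
  proof (rule Brouwer_degree2_eq)
    fix x assume "x \<in> topspace (nsphere p)"
    define y where "y = plmap p P Q x"
    define r where "r = sqrt (\<Sum>k\<le>p. (y k)\<^sup>2)"
    have "(\<Sum>k\<le>p. (y k)\<^sup>2) > 0"
      unfolding sum_squares_pos_iff y_def
      by (rule nondegD[OF PQ topspace_nsphere_nonzero]) fact
    then have r: "r > 0" by (simp add: r_def)
    define z where "z i = (\<Sum>k\<le>p. y k * B k i)" for i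
    have 1: "plmap p B (\<lambda>j i. - B j i) (normalize_to p y) i = z i / r" for i
      unfolding plmap_linear z_def sum_divide_distrib
      by (intro sum.cong) (auto simp: normalize_to_def r_def)
    have 2: "plmap p (\<lambda>j i. \<Sum>k\<le>p. P j k * B k i) (\<lambda>j i. \<Sum>k\<le>p. Q j k * B k i) x i = z i" for i
      unfolding z_def y_def by (rule plmap_linear_image)
    have "(\<Sum>k\<le>p. (z k / r)\<^sup>2) = (\<Sum>k\<le>p. (z k)\<^sup>2) / r\<^sup>2"
      by (simp add: power_divide sum_divide_distrib)
    then have "normalize_to p (\<lambda>i. z i / r) = normalize_to p z"
      using r by (auto simp: normalize_to_def real_sqrt_divide fun_eq_iff)
    then show "(?l \<circ> ?f) x = normalize_to p (plmap p (\<lambda>j i. \<Sum>k\<le>p. P j k * B k i) (\<lambda>j i. \<Sum>k\<le>p. Q j k * B k i) x)"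
      unfolding o_apply y_def[symmetric] 1 2
      by (metis (no_types, lifting) 1 2 normalize_to_cong)
  qed
  finally show ?thesis by simp
qed

section \<open>The degree modulo 2 as a number of cones\<close>

text \<open>Common criterion for the two deformations below. Expanding \<open>y\<close> in the
  columns of \<open>C\<close> turns the equation for a zero into the coordinatewise equations of the
  last hypothesis, whose sum is the total weight on \<open>y\<close>.\<close>

lemma nondeg_basis:
  assumes C: "det (cmat p C) \<noteq> 0"
    and y: "\<And>i. i \<le> p \<Longrightarrow> y i = (\<Sum>j\<le>p. v j * C j i)"
    and ab: "\<And>x. (\<And>j. j \<le> p \<Longrightarrow>
        max 0 (x j) + b j * max 0 (- x j) = (\<Sum>l\<le>p. a l * max 0 (- x l)) * v j) \<Longrightarrow> \<forall>j\<le>p. x j = 0"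
  shows "nondeg p C (\<lambda>j i. b j * C j i - a j * y i)"
  unfolding nondeg_def
proof (intro allI impI)
  fix x i assume x: "\<forall>i\<le>p. plmap p C (\<lambda>j i. b j * C j i - a j * y i) x i = 0" and "i \<le> p"
  let ?m = "\<Sum>l\<le>p. a l * max 0 (- x l)"
  have "(\<Sum>j\<le>p. (max 0 (x j) + b j * max 0 (- x j) - ?m * v j) * C j i) = 0" if i: "i \<le> p" for i
  proof -
    have "0 = (\<Sum>j\<le>p. (max 0 (x j) + b j * max 0 (- x j)) * C j i - a j * max 0 (- x j) * y i)"
      using x i unfolding plmap_def by (simp add: algebra_simps)
    also have "\<dots> = (\<Sum>j\<le>p. (max 0 (x j) + b j * max 0 (- x j)) * C j i) - ?m * y i"
      by (simp only: sum_subtractf sum_distrib_right)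
    also have "?m * y i = (\<Sum>j\<le>p. ?m * v j * C j i)"
      unfolding y[OF i] sum_distrib_left[of ?m] by (simp add: mult.assoc)
    finally show ?thesis
      by (simp add: left_diff_distrib sum_subtractf)
  qed
  then have "max 0 (x j) + b j * max 0 (- x j) - ?m * v j = 0" if "j \<le> p" for j
    by (rule cmat_independent[OF C _ that])
  then have "\<forall>j\<le>p. x j = 0"
    by (intro ab) (simp only: right_minus_eq)
  then show "x i = 0"
    using \<open>i \<le> p\<close> by blast
qed

lemma odd_lindeg:
  assumes "det (cmat p C) \<noteq> 0"
  shows "odd (lindeg p C)"
proof -
  have "real_of_int (lindeg p C) = 1 \<or> real_of_int (lindeg p C) = -1"
    unfolding lindeg_eq_sgn_det[OF assms] using assms by (simp add: sgn_if)
  then have "lindeg p C = 1 \<or> lindeg p C = -1" by linarith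
  then show ?thesis by auto
qed

text \<open>With \<open>y\<close> inside the open cone, every column \<open>- y\<close> moves
  straight to \<open>- C j\<close> without degeneration, which ends at the linear isomorphism given
  by \<open>C\<close>.\<close>

lemma odd_pldeg_cone:
  assumes C: "det (cmat p C) \<noteq> 0"
    and y: "\<And>i. i \<le> p \<Longrightarrow> y i = (\<Sum>j\<le>p. v j * C j i)"
    and v: "\<And>j. j \<le> p \<Longrightarrow> v j > 0"
  shows "odd (pldeg p C (\<lambda>j i. - y i))"
proof -
  have "pldeg p C (\<lambda>j i. - y i) = lindeg p C"
  proof (rule pldeg_homotopy)
    fix t :: real assume t: "0 \<le> t" "t \<le> 1"
    have "nondeg p C (\<lambda>j i. (- t) * C j i - (1 - t) * y i)"
    proof (rule nondeg_basis[OF C y])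
      fix x :: "nat \<Rightarrow> real"
      let ?m = "\<Sum>l\<le>p. (1 - t) * max 0 (- x l)"
      assume x: "\<And>j. j \<le> p \<Longrightarrow> max 0 (x j) + - t * max 0 (- x j) = ?m * v j"
      have m: "?m = (1 - t) * (\<Sum>l\<le>p. max 0 (- x l))"
        by (simp add: sum_distrib_left)
      have m0: "?m \<ge> 0" using t by (intro sum_nonneg) auto
      \<comment> \<open>For \<open>x j < 0\<close> the equation compares
        \<open>t * x j \<le> 0\<close> with \<open>?m * v j \<ge> 0\<close>, so both vanish. Then
        \<open>t = 0\<close>, so \<open>?m\<close> is the sum of all negative parts, and it is
        0.\<close>
      have nonneg: "x j \<ge> 0" if j: "j \<le> p" for j
      proof (rule ccontr)
        assume neg: "\<not> 0 \<le> x j"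
        have "?m * v j \<ge> 0" using m0 v[OF j] by simp
        moreover have eq: "t * x j = ?m * v j" using x[OF j] neg by (simp add: max_def)
        moreover have "t * x j \<le> 0" using neg t by (simp add: mult_nonneg_nonpos)
        ultimately have "t * x j = 0" by linarith
        then have "t = 0" using neg by auto
        moreover have "?m = 0" using eq \<open>t * x j = 0\<close> v[OF j] by auto
        ultimately have "(\<Sum>l\<le>p. max 0 (- x l)) = 0" unfolding m by simp
        then have "\<forall>l\<in>{..p}. max 0 (- x l) = 0"
          by (subst (asm) sum_nonneg_eq_0_iff) auto
        then have "max 0 (- x j) = 0" using j by blast
        then show False using neg by (simp add: max_def split: if_splits)
      qed
      then have m: "?m = 0" by (intro sum.neutral) auto
      show "\<forall>j\<le>p. x j = 0"
      proof (intro allI impI)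
        fix j assume j: "j \<le> p"
        show "x j = 0"
          using x[OF j] nonneg[OF j] unfolding m by simp
      qed
    qed
    moreover have "(\<lambda>j i. (1 - t) * C j i + t * C j i) = C"
      by (auto simp: algebra_simps)
    moreover have "(\<lambda>j i. (1 - t) * (- y i) + t * - C j i) = (\<lambda>j i. (- t) * C j i - (1 - t) * y i)"
      by (auto simp: algebra_simps)
    ultimately show "nondeg p (\<lambda>j i. (1 - t) * C j i + t * C j i) (\<lambda>j i. (1 - t) * (- y i) + t * - C j i)"
      by simp
  qed
  then show ?thesis
    using odd_lindeg[OF C] by simp
qed

text \<open>As \<open>v k < 0\<close>, the image of \<open>- e_k\<close> alone can be moved from
  \<open>- y\<close> to \<open>C k\<close>: in the equation for coordinate \<open>k\<close> the left
  side is nonnegative and the right side nonpositive. At the end both images on the axis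
  \<open>k\<close> agree.\<close>

lemma pldeg_off_cone:
  assumes C: "det (cmat p C) \<noteq> 0"
    and y: "\<And>i. i \<le> p \<Longrightarrow> y i = (\<Sum>j\<le>p. v j * C j i)"
    and k: "k \<le> p" and v: "v k < 0"
  shows "pldeg p C (\<lambda>j i. - y i) = 0"
proof -
  let ?Q = "(\<lambda>j i. - y i)(k := C k)"
  have nd: "nondeg p (\<lambda>j i. (1 - t) * C j i + t * C j i) (\<lambda>j i. (1 - t) * (- y i) + t * ?Q j i)"
    if t: "0 \<le> t" "t \<le> 1" for t
  proof -
    define a where "a j = (if j = k then 1 - t else 1)" for j
    define b where "b j = (if j = k then t else 0)" for j
    have "nondeg p C (\<lambda>j i. b j * C j i - a j * y i)"
    proof (rule nondeg_basis[OF C y])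
      fix x :: "nat \<Rightarrow> real"
      let ?m = "\<Sum>l\<le>p. a l * max 0 (- x l)"
      assume x: "\<And>j. j \<le> p \<Longrightarrow> max 0 (x j) + b j * max 0 (- x j) = ?m * v j"
      have a: "a j \<ge> 0" for j using t by (simp add: a_def)
      have m0: "?m \<ge> 0" using a by (intro sum_nonneg) auto
      have "?m * v k \<le> 0" using m0 v by (simp add: mult_nonneg_nonpos)
      moreover have "t * max 0 (- x k) \<ge> 0" using t by simp
      moreover have "max 0 (x k) + t * max 0 (- x k) = ?m * v k"
        using x[OF k] by (simp add: b_def)
      moreover have "max 0 (x k) \<ge> 0" by simp
      ultimately have 0: "t * max 0 (- x k) = 0" "?m * v k = 0"
        by linarith+
      then have m: "?m = 0" using v by simp
      then have "\<forall>l\<in>{..p}. a l * max 0 (- x l) = 0"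
        by (subst (asm) sum_nonneg_eq_0_iff) (use a in auto)
      then have al: "a l * max 0 (- x l) = 0" if "l \<le> p" for l using that by blast
      have "max 0 (- x k) = 0"
        using al[OF k] 0(1) by (cases "t = 0") (auto simp: a_def)
      then have neg: "max 0 (- x j) = 0" if "j \<le> p" for j
        using al[OF that] by (cases "j = k") (auto simp: a_def)
      show "\<forall>j\<le>p. x j = 0"
      proof (intro allI impI)
        fix j assume j: "j \<le> p"
        have "max 0 (x j) = 0"
          using x[OF j] neg[OF j] unfolding m by simp
        then show "x j = 0"
          using neg[OF j] by (simp add: max_def split: if_splits)
      qed
    qed
    moreover have "(\<lambda>j i. (1 - t) * C j i + t * C j i) = C"
      by (auto simp: algebra_simps)
    moreover have "(\<lambda>j i. (1 - t) * (- y i) + t * ?Q j i) = (\<lambda>j i. b j * C j i - a j * y i)"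
      by (auto simp: a_def b_def algebra_simps)
    ultimately show ?thesis by simp
  qed
  have "pldeg p C (\<lambda>j i. - y i) = pldeg p C ?Q"
    by (rule pldeg_homotopy) (rule nd)
  also have "\<dots> = 0"
    by (rule pldeg_equal_columns[OF k]) (use nd[of 1] in \<open>simp_all add: fun_upd_def\<close>)
  finally show ?thesis .
qed

text \<open>The generators of the image cone of the orthant whose negative coordinates are those in
  \<open>J\<close>.\<close>

definition pick :: "nat set \<Rightarrow> (nat \<Rightarrow> 'a) \<Rightarrow> (nat \<Rightarrow> 'a) \<Rightarrow> nat \<Rightarrow> 'a" where
  "pick J P Q j = (if j \<in> J then Q j else P j)"

text \<open>\<open>v J\<close> holds the coordinates of \<open>y\<close> with respect to the
  generators for \<open>J\<close>. If they are nonzero, \<open>y\<close> is off the hyperplanes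
  spanned by the facets; if they are positive, \<open>y\<close> has a preimage in the orthant of
  \<open>J\<close>.\<close>

locale regular_value =
  fixes p :: nat and P Q :: "nat \<Rightarrow> nat \<Rightarrow> real" and y :: "nat \<Rightarrow> real" and v :: "nat set \<Rightarrow> nat \<Rightarrow> real"
  assumes det_pick: "J \<subseteq> {..p} \<Longrightarrow> det (cmat p (pick J P Q)) \<noteq> 0"
    and solution: "J \<subseteq> {..p} \<Longrightarrow> i \<le> p \<Longrightarrow> y i = (\<Sum>j\<le>p. v J j * pick J P Q j i)"
    and nonzero: "J \<subseteq> {..p} \<Longrightarrow> j \<le> p \<Longrightarrow> v J j \<noteq> 0"
begin

text \<open>Ensures that all maps met in the expansion have a degree. At a zero, a combination of
  the generators outside \<open>K\<close> equals the multiple \<open>?m\<close> of \<open>y\<close>.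
  For \<open>k\<close> in \<open>K\<close> the coefficient is 0 on the one side and
  \<open>?m * v J k\<close> on the other, so \<open>?m = 0\<close>.\<close>

lemma nondeg_mixed:
  assumes "\<And>j. j \<le> p \<Longrightarrow> P' j \<in> {P j, Q j, \<lambda>i. - y i}"
    and "\<And>j. j \<le> p \<Longrightarrow> Q' j \<in> {P j, Q j, \<lambda>i. - y i}"
  shows "nondeg p P' Q'"
  unfolding nondeg_def
proof (intro allI impI)
  fix x i assume x: "\<forall>i\<le>p. plmap p P' Q' x i = 0" and "i \<le> p"
  define c where "c j = (if x j \<ge> 0 then P' j else Q' j)" for j
  define K where "K = {j. j \<le> p \<and> c j = (\<lambda>i. - y i)}"
  define J where "J = {j. j \<le> p \<and> j \<notin> K \<and> c j \<noteq> P j}"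
  have J: "J \<subseteq> {..p}" by (auto simp: J_def)
  have c: "c j = pick J P Q j" if "j \<le> p" "j \<notin> K" for j
    using assms[of j] that unfolding K_def J_def c_def pick_def by (auto split: if_splits)
  let ?m = "\<Sum>l\<le>p. if l \<in> K then \<bar>x l\<bar> else 0"
  let ?u = "\<lambda>j. (if j \<in> K then 0 else \<bar>x j\<bar>) - ?m * v J j"
  have "(\<Sum>j\<le>p. ?u j * pick J P Q j i) = 0" if i: "i \<le> p" for i
  proof -
    have "0 = (\<Sum>j\<le>p. \<bar>x j\<bar> * c j i)"
    proof -
      have "plmap p P' Q' x i = (\<Sum>j\<le>p. \<bar>x j\<bar> * c j i)"
        unfolding plmap_def c_def by (rule sum.cong) auto
      then show ?thesis using x i by simp
    qed
    also have "\<dots> = (\<Sum>j\<le>p. (if j \<in> K then 0 else \<bar>x j\<bar>) * pick J P Q j i - (if j \<in> K then \<bar>x j\<bar> else 0) * y i)"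
    proof (rule sum.cong)
      fix j assume "j \<in> {..p}"
      then show "\<bar>x j\<bar> * c j i
        = (if j \<in> K then 0 else \<bar>x j\<bar>) * pick J P Q j i - (if j \<in> K then \<bar>x j\<bar> else 0) * y i"
        using c[of j] by (cases "j \<in> K") (auto simp: K_def)
    qed simp
    also have "\<dots> = (\<Sum>j\<le>p. (if j \<in> K then 0 else \<bar>x j\<bar>) * pick J P Q j i) - ?m * y i"
      by (simp only: sum_subtractf sum_distrib_right)
    also have "?m * y i = (\<Sum>j\<le>p. ?m * v J j * pick J P Q j i)"
      unfolding solution[OF J i] sum_distrib_left[of ?m] by (simp add: mult.assoc)
    finally show ?thesis
      by (simp add: left_diff_distrib sum_subtractf)
  qed
  then have u: "(if j \<in> K then 0 else \<bar>x j\<bar>) = ?m * v J j" if "j \<le> p" for j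
    using cmat_independent[OF det_pick[OF J] _ that, of ?u] by simp
  have m: "?m = 0"
  proof (cases "K = {}")
    case False
    then obtain k where "k \<in> K" by blast
    then show ?thesis
      using u[of k] nonzero[OF J, of k] by (simp add: K_def)
  qed simp
  then have "\<forall>l\<in>{..p}. (if l \<in> K then \<bar>x l\<bar> else 0) = 0"
    by (subst (asm) sum_nonneg_eq_0_iff) auto
  then have "(if i \<in> K then \<bar>x i\<bar> else 0) = 0"
    using \<open>i \<le> p\<close> by blast
  then show "x i = 0"
    using u[of i] m \<open>i \<le> p\<close> by (cases "i \<in> K") auto
qed

text \<open>The pair \<open>(P k, Q k)\<close> splits into \<open>(P k, - y)\<close> and
  \<open>(- y, Q k)\<close>, and the latter has the negative of the degree of
  \<open>(Q k, - y)\<close>. Each coordinate doubles the number of terms; the signs that accumulate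
  are invisible modulo 2.\<close>

lemma pldeg_expand:
  assumes "k \<le> Suc p"
  shows "even (pldeg p P Q - (\<Sum>J\<in>Pow {..<k}.
    pldeg p (\<lambda>j. if j < k then pick J P Q j else P j) (\<lambda>j. if j < k then (\<lambda>i. - y i) else Q j)))"
  using assms
proof (induction k)
  case 0
  then show ?case by simp
next
  case (Suc k)
  then have k: "k \<le> p" by simp
  let ?P = "\<lambda>k J j. if j < k then pick J P Q j else P j" and ?Q = "\<lambda>k j. if j < k then (\<lambda>i. - y i) else Q j"
  let ?d = "\<lambda>k J. pldeg p (?P k J) (?Q k)"
  have split: "?d k J = ?d (Suc k) J - ?d (Suc k) (insert k J)" if "J \<subseteq> {..<k}" for J
  proof -
    let ?P' = "?P k J" and ?Q' = "?Q k" and ?y = "\<lambda>i. - y i"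
    have mixed: "?P' j \<in> {P j, Q j, ?y}" "?Q' j \<in> {P j, Q j, ?y}" for j
      by (auto simp: pick_def)
    have 1: "nondeg p (?P'(k := P k)) (?Q'(k := ?y))"
      and 2: "nondeg p (?P'(k := Q k)) (?Q'(k := ?y))"
      and 3: "nondeg p (?P'(k := ?y)) (?Q'(k := Q k))"
      by (rule nondeg_mixed; use mixed in \<open>auto simp del: if_split\<close>)+
    have "?d k J = pldeg p (?P'(k := P k)) (?Q'(k := Q k))"
      by (rule pldeg_cong) auto
    also have "\<dots> = pldeg p (?P'(k := P k)) (?Q'(k := ?y)) + pldeg p (?P'(k := ?y)) (?Q'(k := Q k))"
      using k 1 3 by (rule pldeg_additive)
    also have "pldeg p (?P'(k := ?y)) (?Q'(k := Q k)) = - pldeg p (?P'(k := Q k)) (?Q'(k := ?y))"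
      using pldeg_swap[OF k 2] by simp
    also have "?P'(k := P k) = ?P (Suc k) J"
      using that by (auto simp: fun_eq_iff pick_def less_Suc_eq)
    also have "?P'(k := Q k) = ?P (Suc k) (insert k J)"
      using that by (auto simp: fun_eq_iff pick_def less_Suc_eq)
    also have "?Q'(k := ?y) = ?Q (Suc k)"
      by (auto simp: fun_eq_iff less_Suc_eq)
    finally show ?thesis by simp
  qed
  have "(\<Sum>J\<in>Pow {..<Suc k}. ?d (Suc k) J)
      = (\<Sum>J\<in>Pow {..<k}. ?d (Suc k) J) + (\<Sum>J\<in>Pow {..<k}. ?d (Suc k) (insert k J))"
  proof -
    have "inj_on (insert k) (Pow {..<k})"
      by (rule inj_onI) (metis Pow_iff insert_ident lessThan_iff less_irrefl subsetD)
    moreover have "Pow {..<k} \<inter> insert k ` Pow {..<k} = {}"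
      by auto
    ultimately show ?thesis
      by (simp add: lessThan_Suc Pow_insert sum.union_disjoint sum.reindex)
  qed
  moreover have "(\<Sum>J\<in>Pow {..<k}. ?d k J) = (\<Sum>J\<in>Pow {..<k}. ?d (Suc k) J) - (\<Sum>J\<in>Pow {..<k}. ?d (Suc k) (insert k J))"
    unfolding sum_subtractf[symmetric] by (rule sum.cong) (use split in auto)
  ultimately show ?case
    using Suc by simp
qed

text \<open>After expansion in every coordinate, the term of \<open>J\<close> is odd if
  \<open>y\<close> lies in the image cone of \<open>J\<close> and 0 otherwise.\<close>

theorem pldeg_parity:
  "even (pldeg p P Q - int (card {J. J \<subseteq> {..p} \<and> (\<forall>j\<le>p. v J j > 0)}))"
proof -
  let ?S = "{J. J \<subseteq> {..p} \<and> (\<forall>j\<le>p. v J j > 0)}"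
  let ?d = "\<lambda>J. pldeg p (pick J P Q) (\<lambda>j i. - y i)"
  have "even (pldeg p P Q - (\<Sum>J\<in>Pow {..<Suc p}. pldeg p (\<lambda>j. if j < Suc p then pick J P Q j else P j)
      (\<lambda>j. if j < Suc p then (\<lambda>i. - y i) else Q j)))"
    by (rule pldeg_expand) simp
  also have "(\<Sum>J\<in>Pow {..<Suc p}. pldeg p (\<lambda>j. if j < Suc p then pick J P Q j else P j)
      (\<lambda>j. if j < Suc p then (\<lambda>i. - y i) else Q j)) = (\<Sum>J\<in>Pow {..p}. ?d J)"
    unfolding lessThan_Suc_atMost by (intro sum.cong pldeg_cong) auto
  finally have 1: "even (pldeg p P Q - (\<Sum>J\<in>Pow {..p}. ?d J))" .
  have "even (?d J - (if J \<in> ?S then 1 else 0))" if J: "J \<in> Pow {..p}" for J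
  proof (cases "J \<in> ?S")
    case True
    then show ?thesis
      using odd_pldeg_cone[OF det_pick solution] by auto
  next
    case False
    then obtain j where "j \<le> p" "v J j < 0"
      using J nonzero[of J] by (auto simp: not_less order_le_less)
    then show ?thesis
      using J False pldeg_off_cone[OF det_pick solution] by auto
  qed
  then have "even (\<Sum>J\<in>Pow {..p}. ?d J - (if J \<in> ?S then 1 else 0))"
    by (rule dvd_sum)
  moreover have "(\<Sum>J\<in>Pow {..p}. if J \<in> ?S then 1 else 0 :: int) = int (card ?S)"
  proof -
    have "?S = {J \<in> Pow {..p}. J \<in> ?S}" by auto
    then show ?thesis
      by (simp add: sum.If_cases Int_def)
  qed
  ultimately have "even ((\<Sum>J\<in>Pow {..p}. ?d J) - int (card ?S))"
    by (simp only: sum_subtractf)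
  with 1 show ?thesis
    by presburger
qed

end

section \<open>Generic vectors and signed eigenvectors\<close>

text \<open>\<open>q\<close> is the adjugate of \<open>X - B\<close> over the polynomial ring,
  applied to the constant vector \<open>c\<close>. Where \<open>char_poly B\<close> does not vanish,
  the quotients \<open>q i / char_poly B\<close> solve \<open>(x - B) v = c\<close>.\<close>

lemma char_poly_solution:
  fixes B :: "real mat"
  assumes B: "B \<in> carrier_mat n n"
  obtains q where "\<And>i. i < n \<Longrightarrow>
    [:0, 1:] * q i - (\<Sum>j<n. Polynomial.smult (B $$ (i, j)) (q j)) = Polynomial.smult (c i) (char_poly B)"
proof -
  let ?W = "char_poly_matrix B" and ?c = "vec n (\<lambda>i. [:c i:])"
  have W: "?W \<in> carrier_mat n n"
    using B by (simp add: char_poly_matrix_def)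
  define v where "v = adj_mat ?W *\<^sub>v ?c"
  have adj: "adj_mat ?W \<in> carrier_mat n n" "?W * adj_mat ?W = det ?W \<cdot>\<^sub>m 1\<^sub>m n"
    using adj_mat[OF W] by auto
  have "?W *\<^sub>v v = (?W * adj_mat ?W) *\<^sub>v ?c"
    unfolding v_def by (rule assoc_mult_mat_vec[OF W adj(1), symmetric]) simp
  also have "\<dots> = det ?W \<cdot>\<^sub>v ?c"
    unfolding adj by (rule smult_one_mult_vec) simp
  finally have eq: "?W *\<^sub>v v = char_poly B \<cdot>\<^sub>v ?c"
    by (simp add: char_poly_def)
  have v: "v \<in> carrier_vec n"
    using adj by (simp add: v_def)
  show thesis
  proof (rule that)
    fix i assume i: "i < n"
    have "(?W *\<^sub>v v) $ i = (\<Sum>j<n. ?W $$ (i, j) * v $ j)"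
      using i W v by (simp add: scalar_prod_def atLeast0LessThan)
    also have "\<dots> = (\<Sum>j<n. (if i = j then [:0, 1:] * v $ j else 0) - Polynomial.smult (B $$ (i, j)) (v $ j))"
      using i B by (intro sum.cong) (auto simp: char_poly_matrix_def)
    also have "\<dots> = [:0, 1:] * v $ i - (\<Sum>j<n. Polynomial.smult (B $$ (i, j)) (v $ j))"
      using i by (simp add: sum_subtractf)
    finally show "[:0, 1:] * v $ i - (\<Sum>j<n. Polynomial.smult (B $$ (i, j)) (v $ j))
        = Polynomial.smult (c i) (char_poly B)"
      using i unfolding eq by simp
  qed
qed

text \<open>Along the curve \<open>(1, x, x^2, ...)\<close> a nonzero functional is a nonzero
  polynomial in \<open>x\<close>, so finitely many functionals exclude only finitely many
  \<open>x\<close>.\<close>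

lemma nonzero_on_moment_curve:
  assumes "finite F" "\<And>f. f \<in> F \<Longrightarrow> \<exists>i\<le>p. f i \<noteq> (0::real)"
  obtains x :: real where "\<And>f. f \<in> F \<Longrightarrow> (\<Sum>i\<le>p. f i * x ^ i) \<noteq> 0"
proof -
  define g where "g f = (\<Sum>i\<le>p. Polynomial.monom (f i) i)" for f :: "nat \<Rightarrow> real"
  have "g f \<noteq> 0" if "f \<in> F" for f
  proof -
    obtain i where "i \<le> p" "f i \<noteq> 0" using assms(2) \<open>f \<in> F\<close> by blast
    then have "coeff (g f) i \<noteq> 0"
      by (simp add: g_def coeff_sum coeff_monom)
    then show ?thesis by auto
  qed
  then have "finite (\<Union>f\<in>F. {x. poly (g f) x = 0})"
    using assms(1) by (intro finite_UN_I poly_roots_finite) auto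
  then obtain x where "x \<notin> (\<Union>f\<in>F. {x. poly (g f) x = 0})"
    using ex_new_if_finite infinite_UNIV_char_0 by blast
  moreover have "poly (g f) x = (\<Sum>i\<le>p. f i * x ^ i)" for f
    by (simp add: g_def poly_sum poly_monom)
  ultimately show thesis
    using that by auto
qed

text \<open>For a nonzero determinant \<open>f\<close> is row \<open>j\<close> of the adjugate. For
  a singular matrix this row may vanish, so a nonzero vector of the left kernel takes its
  place.\<close>

lemma adjugate_functional:
  assumes j: "j \<le> p"
  obtains f where "\<exists>i\<le>p. f i \<noteq> 0"
    "\<And>k. k \<le> p \<Longrightarrow> (\<Sum>i\<le>p. f i * C k i) = (if k = j then det (cmat p C) else 0)"
proof (cases "det (cmat p C) = 0")
  case True
  let ?T = "transpose_mat (cmat p C)"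
  have "det ?T = 0" "?T \<in> carrier_mat (Suc p) (Suc p)"
    using True det_transpose[OF cmat_carrier] by auto
  then obtain u where u: "u \<in> carrier_vec (Suc p)" "u \<noteq> 0\<^sub>v (Suc p)" "?T *\<^sub>v u = 0\<^sub>v (Suc p)"
    using det_0_iff_vec_prod_zero by blast
  have "(\<Sum>i\<le>p. u $ i * C k i) = (?T *\<^sub>v u) $ k" if "k \<le> p" for k
    using that u(1) by (simp add: cmat_def scalar_prod_def atLeast0LessThan lessThan_Suc_atMost mult.commute)
  then have "(\<Sum>i\<le>p. u $ i * C k i) = 0" if "k \<le> p" for k
    using that u(3) by simp
  moreover have "\<exists>i\<le>p. u $ i \<noteq> 0"
    using u(1,2) by (auto simp: vec_eq_iff less_Suc_eq_le)
  ultimately show thesis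
    using that[of "($) u"] True by auto
next
  case False
  let ?A = "cmat p C" and ?f = "\<lambda>i. adj_mat (cmat p C) $$ (j, i)"
  have adj: "adj_mat ?A \<in> carrier_mat (Suc p) (Suc p)" "adj_mat ?A * ?A = det ?A \<cdot>\<^sub>m 1\<^sub>m (Suc p)"
    using adj_mat[OF cmat_carrier] by auto
  have f: "(\<Sum>i\<le>p. ?f i * C k i) = (if k = j then det ?A else 0)" if k: "k \<le> p" for k
  proof -
    have "(\<Sum>i\<le>p. ?f i * C k i) = (adj_mat ?A * ?A) $$ (j, k)"
      using j k adj(1) by (simp add: scalar_prod_def cmat_def atLeast0LessThan lessThan_Suc_atMost)
    then show ?thesis
      unfolding adj(2) using j k by auto
  qed
  moreover have "\<exists>i\<le>p. ?f i \<noteq> 0"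
  proof (rule ccontr)
    assume "\<not> ?thesis"
    then have "(\<Sum>i\<le>p. ?f i * C j i) = 0" by (intro sum.neutral) auto
    then show False using f[OF j] False by simp
  qed
  ultimately show thesis
    using that[of ?f] by blast
qed

text \<open>If \<open>y\<close> has coordinates \<open>v\<close>, the functional for
  \<open>j\<close> takes the value \<open>v j * det (cmat p C)\<close> at \<open>y\<close>, and
  \<open>y\<close> is chosen off the kernels of all these functionals. For singular \<open>C\<close>
  the implication says that \<open>y\<close> is outside the range.\<close>

lemma generic_vector:
  assumes "finite \<C>"
  shows "\<exists>y. \<forall>C\<in>\<C>. \<forall>v. (\<forall>i\<le>p. y i = (\<Sum>j\<le>p. v j * C j i))
    \<longrightarrow> det (cmat p C) \<noteq> 0 \<and> (\<forall>j\<le>p. v j \<noteq> 0)"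
proof -
  let ?R = "\<lambda>C j f. j \<le> p \<longrightarrow> (\<exists>i\<le>p. f i \<noteq> 0) \<and>
      (\<forall>k\<le>p. (\<Sum>i\<le>p. f i * C k i) = (if k = j then det (cmat p C) else 0))"
  have "\<exists>f. ?R C j f" for C j
  proof (cases "j \<le> p")
    case True
    obtain f where "\<exists>i\<le>p. f i \<noteq> 0"
      "\<And>k. k \<le> p \<Longrightarrow> (\<Sum>i\<le>p. f i * C k i) = (if k = j then det (cmat p C) else 0)"
      using adjugate_functional[OF True, of C] by blast
    then show ?thesis by blast
  qed blast
  then have "?R C j (SOME f. ?R C j f)" for C j
    by (rule someI_ex)
  then obtain f where R: "\<And>C j. ?R C j (f C j)"
    by (rule that[of "\<lambda>C j. SOME f. ?R C j f"])
  from R have f: "\<And>C j. j \<le> p \<Longrightarrow> \<exists>i\<le>p. f C j i \<noteq> 0"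
    "\<And>C j k. \<lbrakk>j \<le> p; k \<le> p\<rbrakk> \<Longrightarrow> (\<Sum>i\<le>p. f C j i * C k i) = (if k = j then det (cmat p C) else 0)"
    by blast+
  let ?F = "(\<lambda>(C, j). f C j) ` (\<C> \<times> {..p})"
  have "finite ?F" using assms by simp
  then obtain x where x: "\<And>g. g \<in> ?F \<Longrightarrow> (\<Sum>i\<le>p. g i * x ^ i) \<noteq> 0"
    by (rule nonzero_on_moment_curve[where p = p]) (use f(1) in auto)
  have "det (cmat p C) \<noteq> 0 \<and> v j \<noteq> 0"
    if C: "C \<in> \<C>" and v: "\<forall>i\<le>p. x ^ i = (\<Sum>j\<le>p. v j * C j i)" and j: "j \<le> p" for C v j
  proof -
    have "(\<Sum>i\<le>p. f C j i * x ^ i) = (\<Sum>i\<le>p. \<Sum>k\<le>p. v k * (f C j i * C k i))"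
      using v by (simp add: sum_distrib_left algebra_simps)
    also have "\<dots> = (\<Sum>k\<le>p. v k * (\<Sum>i\<le>p. f C j i * C k i))"
      by (subst sum.swap) (simp add: sum_distrib_left)
    also have "\<dots> = (\<Sum>k\<le>p. if k = j then v k * det (cmat p C) else 0)"
      using f(2)[OF j] by (intro sum.cong) auto
    also have "\<dots> = v j * det (cmat p C)"
      using j by simp
    finally show ?thesis
      using x[of "f C j"] C j by auto
  qed
  then show ?thesis
    by (intro exI[of _ "\<lambda>i. x ^ i"]) blast
qed

text \<open>The image of \<open>e_j\<close> under \<open>z \<mapsto> x z - A |z|\<close>; replacing
  \<open>x\<close> by \<open>- x\<close> gives the image of \<open>- e_j\<close>.\<close>

definition shifted :: "real mat \<Rightarrow> real \<Rightarrow> nat \<Rightarrow> nat \<Rightarrow> real" where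
  "shifted A x j i = (if i = j then x else 0) - A $$ (i, j)"

definition sg :: "nat set \<Rightarrow> nat \<Rightarrow> real" where
  "sg J i = (if i \<in> J then -1 else 1)"

definition signed_mat :: "nat \<Rightarrow> real mat \<Rightarrow> nat set \<Rightarrow> real mat" where
  "signed_mat p A J = mat (Suc p) (Suc p) (\<lambda>(i, j). sg J i * A $$ (i, j))"

lemma signed_mat_carrier [simp]: "signed_mat p A J \<in> carrier_mat (Suc p) (Suc p)"
  by (simp add: signed_mat_def)

definition signed_eigen :: "nat \<Rightarrow> real mat \<Rightarrow> real \<Rightarrow> nat set \<Rightarrow> (nat \<Rightarrow> real) \<Rightarrow> bool" where
  "signed_eigen p A x J u \<longleftrightarrow> (\<forall>i\<le>p. x * u i = sg J i * (\<Sum>j\<le>p. A $$ (i, j) * u j))"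

text \<open>No bound on \<open>x\<close> is imposed here: the aligned values of the paper are those with \<open>0 \<le> x\<close>.\<close>

definition aligned :: "nat \<Rightarrow> real mat \<Rightarrow> real \<Rightarrow> nat set \<Rightarrow> bool" where
  "aligned p A x J \<longleftrightarrow> (\<exists>u. (\<forall>j\<le>p. u j \<ge> 0) \<and> (\<exists>j\<le>p. u j \<noteq> 0) \<and> signed_eigen p A x J u)"

abbreviation pick_shifted :: "real mat \<Rightarrow> real \<Rightarrow> nat set \<Rightarrow> nat \<Rightarrow> nat \<Rightarrow> real" where
  "pick_shifted A x J \<equiv> pick J (shifted A x) (shifted A (- x))"

text \<open>In matrix terms \<open>pick_shifted A x J\<close> is
  \<open>x S - A = S (x - S A)\<close>, where \<open>S\<close> is the diagonal matrix of the signs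
  \<open>sg J\<close>.\<close>

lemma sum_pick_shifted:
  assumes "i \<le> p"
  shows "(\<Sum>j\<le>p. v j * pick_shifted A x J j i) = sg J i * x * v i - (\<Sum>j\<le>p. A $$ (i, j) * v j)"
proof -
  have "(\<Sum>j\<le>p. v j * pick_shifted A x J j i) = (\<Sum>j\<le>p. (if j = i then sg J i * x * v i else 0) - A $$ (i, j) * v j)"
    by (intro sum.cong) (auto simp: pick_def shifted_def sg_def algebra_simps)
  then show ?thesis
    using assms by (simp add: sum_subtractf)
qed

lemma signed_eigen_iff_kernel:
  "signed_eigen p A x J u \<longleftrightarrow> (\<forall>i\<le>p. (\<Sum>j\<le>p. u j * pick_shifted A x J j i) = 0)"
proof -
  have "x * u i = sg J i * r \<longleftrightarrow> sg J i * x * u i - r = 0" for i r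
    by (auto simp: sg_def)
  then show ?thesis
    unfolding signed_eigen_def by (simp add: sum_pick_shifted)
qed

lemma signed_eigen_iff_mult:
  assumes "u \<in> carrier_vec (Suc p)"
  shows "signed_mat p A J *\<^sub>v u = x \<cdot>\<^sub>v u \<longleftrightarrow> signed_eigen p A x J (($) u)"
proof -
  have "(signed_mat p A J *\<^sub>v u) $ i = sg J i * (\<Sum>j\<le>p. A $$ (i, j) * u $ j)" if "i \<le> p" for i
    using that assms
    by (simp add: signed_mat_def scalar_prod_def atLeast0LessThan lessThan_Suc_atMost sum_distrib_left mult.assoc)
  then show ?thesis
    using assms unfolding vec_eq_iff signed_eigen_def
    by (auto simp: signed_mat_def less_Suc_eq_le)
qed

lemma det_pick_shifted:
  "det (cmat p (pick_shifted A x J)) = 0 \<longleftrightarrow> poly (char_poly (signed_mat p A J)) x = 0"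
proof -
  have "det (cmat p (pick_shifted A x J)) = 0 \<longleftrightarrow>
      (\<exists>u \<in> carrier_vec (Suc p). u \<noteq> 0\<^sub>v (Suc p) \<and> cmat p (pick_shifted A x J) *\<^sub>v u = 0\<^sub>v (Suc p))"
    using det_0_iff_vec_prod_zero[OF cmat_carrier] by blast
  also have "\<dots> \<longleftrightarrow> (\<exists>u \<in> carrier_vec (Suc p). u \<noteq> 0\<^sub>v (Suc p) \<and> signed_mat p A J *\<^sub>v u = x \<cdot>\<^sub>v u)"
  proof (intro bex_cong conj_cong refl)
    fix u :: "real vec" assume u: "u \<in> carrier_vec (Suc p)"
    then have "vec (Suc p) (($) u) = u" by auto
    then have "(cmat p (pick_shifted A x J) *\<^sub>v u) $ i = (\<Sum>j\<le>p. u $ j * pick_shifted A x J j i)" if "i \<le> p" for i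
      using cmat_mult_vec[OF that, of "pick_shifted A x J" "($) u"] by simp
    then have "cmat p (pick_shifted A x J) *\<^sub>v u = 0\<^sub>v (Suc p) \<longleftrightarrow> signed_eigen p A x J (($) u)"
      unfolding signed_eigen_iff_kernel vec_eq_iff by (auto simp: cmat_def less_Suc_eq_le)
    then show "cmat p (pick_shifted A x J) *\<^sub>v u = 0\<^sub>v (Suc p) \<longleftrightarrow> signed_mat p A J *\<^sub>v u = x \<cdot>\<^sub>v u"
      by (simp add: signed_eigen_iff_mult[OF u])
  qed
  also have "\<dots> \<longleftrightarrow> eigenvalue (signed_mat p A J) x"
    by (auto simp: eigenvalue_def eigenvector_def signed_mat_def)
  finally show ?thesis
    by (simp add: eigenvalue_root_char_poly[OF signed_mat_carrier])
qed

lemma aligned_root: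
  assumes "aligned p A x J"
  shows "poly (char_poly (signed_mat p A J)) x = 0"
proof -
  obtain u j where u: "j \<le> p" "u j \<noteq> 0" "signed_eigen p A x J u"
    using assms by (auto simp: aligned_def)
  then show ?thesis
    unfolding signed_eigen_iff_kernel det_pick_shifted[symmetric]
    using cmat_independent by blast
qed

lemma char_poly_nonzero: "char_poly (signed_mat p A J) \<noteq> 0"
  using degree_monic_char_poly[OF signed_mat_carrier] by (metis leading_coeff_0_iff zero_neq_one)

lemma finite_aligned: "finite {x. \<exists>J\<subseteq>{..p}. aligned p A x J}"
proof -
  have "{x. \<exists>J\<subseteq>{..p}. aligned p A x J} \<subseteq> (\<Union>J\<in>Pow {..p}. {x. poly (char_poly (signed_mat p A J)) x = 0})"
    using aligned_root by blast
  moreover have "finite (\<Union>J\<in>Pow {..p}. {x. poly (char_poly (signed_mat p A J)) x = 0})"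
    by (intro finite_UN_I poly_roots_finite char_poly_nonzero) simp
  ultimately show ?thesis by (rule finite_subset)
qed

lemma plmap_shifted:
  assumes "i \<le> p"
  shows "plmap p (shifted A x) (shifted A (- x)) z i = x * z i - (\<Sum>j\<le>p. A $$ (i, j) * \<bar>z j\<bar>)"
proof -
  have "plmap p (shifted A x) (shifted A (- x)) z i = (\<Sum>j\<le>p. (if j = i then x * z i else 0) - A $$ (i, j) * \<bar>z j\<bar>)"
    unfolding plmap_def by (intro sum.cong) (auto simp: shifted_def max_def algebra_simps)
  then show ?thesis
    using assms by (simp add: sum_subtractf)
qed

text \<open>A zero \<open>z\<close> satisfies \<open>x z = A |z|\<close>; with
  \<open>z = S |z|\<close> for the signs of \<open>z\<close> this gives
  \<open>S A |z| = x |z|\<close>, so \<open>|z|\<close> is an aligned vector.\<close>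

lemma nondeg_shifted:
  assumes "\<And>J. J \<subseteq> {..p} \<Longrightarrow> \<not> aligned p A x J"
  shows "nondeg p (shifted A x) (shifted A (- x))"
  unfolding nondeg_def
proof (intro allI impI, rule ccontr)
  fix z i assume z: "\<forall>i\<le>p. plmap p (shifted A x) (shifted A (- x)) z i = 0" and i: "i \<le> p" "z i \<noteq> 0"
  let ?J = "{j. j \<le> p \<and> z j < 0}"
  have "signed_eigen p A x ?J (\<lambda>j. \<bar>z j\<bar>)"
    unfolding signed_eigen_def using z by (auto simp: plmap_shifted sg_def)
  then have "aligned p A x ?J"
    unfolding aligned_def using i by (intro exI[of _ "\<lambda>j. \<bar>z j\<bar>"]) auto
  then show False
    using assms[of ?J] by auto
qed

section \<open>Sign changes at aligned values\<close>

text \<open>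
  At a singular point \<open>x0\<close> whose limit system has no solution, the quotients \<open>q j / d\<close> have a pole, and
  their leading coefficients form a kernel vector.
\<close>

lemma factor_out_root:
  fixes q :: "nat \<Rightarrow> real poly" and d :: "real poly"
  assumes "\<And>i. i \<le> p \<Longrightarrow> [:0, 1:] * q i - (\<Sum>j\<le>p. Polynomial.smult (b i j) (q j)) = Polynomial.smult (c i) d"
    and "d \<noteq> 0" "poly d x0 = 0"
    and nosol: "\<nexists>v. \<forall>i\<le>p. x0 * v i - (\<Sum>j\<le>p. b i j * v j) = c i"
  obtains k r e where "\<And>j. j \<le> p \<Longrightarrow> q j = [:- x0, 1:] ^ k * r j" "d = [:- x0, 1:] ^ k * e"
    "poly e x0 = 0" "\<exists>j\<le>p. poly (r j) x0 \<noteq> 0"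
    "\<And>i. i \<le> p \<Longrightarrow> [:0, 1:] * r i - (\<Sum>j\<le>p. Polynomial.smult (b i j) (r j)) = Polynomial.smult (c i) e"
  using assms(1-3)
\<comment> \<open>A common factor \<open>X - x0\<close> is removed until some numerator is nonzero
  at \<open>x0\<close>; every removal lowers the degree of \<open>d\<close>.\<close>
proof (induction "degree d" arbitrary: q d thesis rule: less_induct)
  case less
  show ?case
  proof (cases "\<exists>j\<le>p. poly (q j) x0 \<noteq> 0")
    case True
    then show ?thesis
      using less.prems by (intro less.prems(1)[of 0 q d]) auto
  next
    case False
    let ?X = "[:- x0, 1:]"
    define q' where "q' j = q j div ?X" for j
    have q: "q j = ?X * q' j" if "j \<le> p" for j
    proof -
      have "?X dvd q j"
        using False that by (auto simp: poly_eq_0_iff_dvd)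
      then show ?thesis
        unfolding q'_def by (rule dvd_mult_div_cancel[symmetric])
    qed
    obtain d' where d: "d = ?X * d'"
      using less.prems(4) by (auto simp: poly_eq_0_iff_dvd)
    then have d': "d' \<noteq> 0"
      using less.prems(3) by auto
    have sys: "[:0, 1:] * q' i - (\<Sum>j\<le>p. Polynomial.smult (b i j) (q' j)) = Polynomial.smult (c i) d'"
      if i: "i \<le> p" for i
    proof -
      have "?X * ([:0, 1:] * q' i - (\<Sum>j\<le>p. Polynomial.smult (b i j) (q' j)))
          = [:0, 1:] * q i - (\<Sum>j\<le>p. Polynomial.smult (b i j) (q j))"
      proof -
        have "(\<Sum>j\<le>p. Polynomial.smult (b i j) (q j)) = ?X * (\<Sum>j\<le>p. Polynomial.smult (b i j) (q' j))"
          unfolding sum_distrib_left by (intro sum.cong) (simp_all only: q atMost_iff mult_smult_right)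
        then show ?thesis
          unfolding q[OF i] by (simp only: right_diff_distrib mult.left_commute)
      qed
      also have "\<dots> = ?X * Polynomial.smult (c i) d'"
        unfolding less.prems(2)[OF i] d by (simp only: mult_smult_right)
      finally show ?thesis
        by (simp only: mult_cancel_left) auto
    qed
    \<comment> \<open>Otherwise the quotients \<open>q' j / d'\<close> at \<open>x0\<close> would
      solve the system that has no solution.\<close>
    have "poly d' x0 = 0"
    proof (rule ccontr)
      assume nz: "poly d' x0 \<noteq> 0"
      have "\<forall>i\<le>p. x0 * (poly (q' i) x0 / poly d' x0) - (\<Sum>j\<le>p. b i j * (poly (q' j) x0 / poly d' x0)) = c i"
      proof (intro allI impI)
        fix i assume "i \<le> p"
        then have "poly ([:0, 1:] * q' i - (\<Sum>j\<le>p. Polynomial.smult (b i j) (q' j))) x0 = c i * poly d' x0"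
          by (simp only: sys poly_smult)
        then have "(x0 * poly (q' i) x0 - (\<Sum>j\<le>p. b i j * poly (q' j) x0)) / poly d' x0 = c i"
          using nz by (simp add: poly_sum)
        then show "x0 * (poly (q' i) x0 / poly d' x0) - (\<Sum>j\<le>p. b i j * (poly (q' j) x0 / poly d' x0)) = c i"
          by (simp add: diff_divide_distrib sum_divide_distrib)
      qed
      then show False
        using nosol by (auto dest!: spec[where x = "\<lambda>j. poly (q' j) x0 / poly d' x0"])
    qed
    note root = this
    have deg: "degree d' < degree d"
      using d' unfolding d by (subst degree_mult_eq) auto
    show ?thesis
    proof (rule less.hyps[OF deg _ sys d' root])
      fix k r e
      assume *: "\<And>j. j \<le> p \<Longrightarrow> q' j = ?X ^ k * r j" "d' = ?X ^ k * e"
        "poly e x0 = 0" "\<exists>j\<le>p. poly (r j) x0 \<noteq> 0"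
        "\<And>i. i \<le> p \<Longrightarrow> [:0, 1:] * r i - (\<Sum>j\<le>p. Polynomial.smult (b i j) (r j)) = Polynomial.smult (c i) e"
      show ?thesis
      proof (rule less.prems(1)[OF _ _ *(3-5)])
        show "q j = ?X ^ Suc k * r j" if "j \<le> p" for j
          unfolding q[OF that] *(1)[OF that] power_Suc mult.assoc ..
        show "d = ?X ^ Suc k * e"
          unfolding d *(2) power_Suc mult.assoc ..
      qed
    qed
  qed
qed

section \<open>Signs of rational functions near a point\<close>

lemma poly_tendsto_within:
  fixes g :: "real poly"
  shows "(poly g \<longlongrightarrow> poly g a) (at a within S)"
  using poly_isCont[where p = g and x = a] by (auto simp: isCont_def intro: tendsto_within_subset)

lemma poly_eventually_nonzero:
  fixes g :: "real poly"
  assumes "g \<noteq> 0"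
  shows "\<forall>\<^sub>F x in at a within S. poly g x \<noteq> 0"
proof -
  have "\<not> a islimpt {x. poly g x = 0}"
    using poly_roots_finite[OF assms] by (simp add: islimpt_finite)
  then have "\<forall>\<^sub>F x in at a. poly g x \<noteq> 0"
    by (simp add: islimpt_iff_eventually)
  then show ?thesis
    by (rule filter_leD[OF at_le[OF subset_UNIV]])
qed

lemma eventually_positive_iff:
  fixes f :: "nat \<Rightarrow> real \<Rightarrow> real"
  assumes "\<And>j. j \<le> p \<Longrightarrow> (f j \<longlongrightarrow> v j) F" "\<And>j. j \<le> p \<Longrightarrow> v j \<noteq> 0"
  shows "\<forall>\<^sub>F x in F. (\<forall>j\<le>p. f j x > 0) \<longleftrightarrow> (\<forall>j\<le>p. v j > 0)"
proof -
  have "\<forall>\<^sub>F x in F. f j x > 0 \<longleftrightarrow> v j > 0" if j: "j \<le> p" for j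
  proof (cases "v j > 0")
    case True
    then show ?thesis
      using order_tendstoD(1)[OF assms(1)[OF j], of 0] by (auto elim: eventually_mono)
  next
    case False
    then have "v j < 0" using assms(2)[OF j] by simp
    then show ?thesis
      using order_tendstoD(2)[OF assms(1)[OF j], of 0] by (auto elim: eventually_mono)
  qed
  then have "\<forall>\<^sub>F x in F. \<forall>j\<in>{..p}. f j x > 0 \<longleftrightarrow> v j > 0"
    by (intro eventually_ball_finite) auto
  then show ?thesis
    by (rule eventually_mono) auto
qed

text \<open>Multiplying each row by its sign turns \<open>S (x - S A) v = y\<close> into
  \<open>(x - S A) v = S y\<close>, so that the denominators of the solution are characteristic
  polynomials.\<close>

lemma solution_iff_shifted:
  assumes "i \<le> p"
  shows "y i = (\<Sum>j\<le>p. v j * pick_shifted A x J j i)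
    \<longleftrightarrow> x * v i - (\<Sum>j\<le>p. sg J i * A $$ (i, j) * v j) = sg J i * y i"
  unfolding sum_pick_shifted[OF assms]
  by (cases "i \<in> J") (auto simp: sg_def sum_negf)

locale generic_family =
  fixes p :: nat and A :: "real mat"
  assumes strict: "\<lbrakk>0 \<le> x; J \<subseteq> {..p}; signed_eigen p A x J u; \<forall>j\<le>p. 0 \<le> u j; \<exists>j\<le>p. u j \<noteq> 0; i \<le> p\<rbrakk> \<Longrightarrow> 0 < u i"
    and simple: "\<lbrakk>0 \<le> x; J \<subseteq> {..p}; aligned p A x J\<rbrakk> \<Longrightarrow> Polynomial.order x (char_poly (signed_mat p A J)) = 1"
begin

text \<open>
  Subtracting the largest possible multiple of the positive vector \<open>u\<close> from \<open>w\<close> leaves a nonnegative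
  eigenvector with a zero entry, which must vanish.
\<close>

lemma eigenspace_line:
  assumes x: "0 \<le> x" and J: "J \<subseteq> {..p}" and u: "signed_eigen p A x J u" "\<And>j. j \<le> p \<Longrightarrow> 0 < u j"
    and w: "signed_eigen p A x J w"
  obtains \<kappa> where "\<And>j. j \<le> p \<Longrightarrow> w j = \<kappa> * u j"
proof -
  define \<kappa> where "\<kappa> = Min ((\<lambda>j. w j / u j) ` {..p})"
  let ?z = "\<lambda>j. w j - \<kappa> * u j"
  have "\<kappa> \<in> (\<lambda>j. w j / u j) ` {..p}"
    unfolding \<kappa>_def by (intro Min_in) auto
  then obtain i where i: "i \<le> p" "\<kappa> = w i / u i" by auto
  have "\<kappa> \<le> w j / u j" if "j \<le> p" for j
    unfolding \<kappa>_def using that by (intro Min_le) auto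
  then have nonneg: "\<forall>j\<le>p. 0 \<le> ?z j"
    using u(2) by (auto simp: pos_le_divide_eq)
  have "signed_eigen p A x J ?z"
    unfolding signed_eigen_iff_kernel
  proof (intro allI impI)
    fix l assume "l \<le> p"
    then show "(\<Sum>j\<le>p. ?z j * pick_shifted A x J j l) = 0"
      using u(1) w unfolding signed_eigen_iff_kernel
      by (simp add: left_diff_distrib sum_subtractf mult.assoc flip: sum_distrib_left)
  qed
  moreover have "?z i = 0"
    using i u(2)[OF i(1)] by simp
  ultimately have "?z j = 0" if "j \<le> p" for j
    using strict[OF x J _ nonneg _ i(1)] that by fastforce
  then show thesis
    by (intro that[of \<kappa>]) simp
qed

text \<open>If \<open>x0\<close> is no eigenvalue of \<open>S A\<close>, the solution is continuous
  there with nonzero coordinates, and the signs stay. At an eigenvalue that is not aligned, the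
  leading coefficients of the pole form an eigenvector with entries of both signs, so positivity
  fails on both sides. At an aligned one, the pole is simple and its leading coefficients are a
  nonzero multiple of a positive vector, so positivity holds on exactly one side.\<close>

lemma sign_jump:
  assumes x0: "0 \<le> x0" and J: "J \<subseteq> {..p}"
    and sys: "\<And>i. i \<le> p \<Longrightarrow> [:0, 1:] * q i - (\<Sum>j\<le>p. Polynomial.smult (sg J i * A $$ (i, j)) (q j))
      = Polynomial.smult (sg J i * y i) d"
    and d: "d = char_poly (signed_mat p A J)"
    and y: "\<And>v j. \<lbrakk>\<And>i. i \<le> p \<Longrightarrow> y i = (\<Sum>j\<le>p. v j * pick_shifted A x0 J j i); j \<le> p\<rbrakk>
      \<Longrightarrow> det (cmat p (pick_shifted A x0 J)) \<noteq> 0 \<and> v j \<noteq> 0"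
  obtains b c where
    "\<forall>\<^sub>F x in at_left x0. (\<forall>j\<le>p. poly (q j) x / poly d x > 0) \<longleftrightarrow> b"
    "\<forall>\<^sub>F x in at_right x0. (\<forall>j\<le>p. poly (q j) x / poly d x > 0) \<longleftrightarrow> c"
    "b \<noteq> c \<longleftrightarrow> aligned p A x0 J"
proof (cases "poly d x0 = 0")
  case False
  have "poly ([:0, 1:] * q i - (\<Sum>j\<le>p. Polynomial.smult (sg J i * A $$ (i, j)) (q j))) x0
      = sg J i * y i * poly d x0" if "i \<le> p" for i
    by (simp only: sys[OF that] poly_smult)
  then have "(x0 * poly (q i) x0 - (\<Sum>j\<le>p. sg J i * A $$ (i, j) * poly (q j) x0)) / poly d x0 = sg J i * y i"
    if "i \<le> p" for i
    using that False by (simp add: poly_sum)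
  then have "x0 * (poly (q i) x0 / poly d x0) - (\<Sum>j\<le>p. sg J i * A $$ (i, j) * (poly (q j) x0 / poly d x0)) = sg J i * y i"
    if "i \<le> p" for i
    using that by (simp add: diff_divide_distrib sum_divide_distrib)
  then have "y i = (\<Sum>j\<le>p. poly (q j) x0 / poly d x0 * pick_shifted A x0 J j i)" if "i \<le> p" for i
    unfolding solution_iff_shifted[OF that, where v = "\<lambda>j. poly (q j) x0 / poly d x0"] using that .
  then have nz: "poly (q j) x0 / poly d x0 \<noteq> 0" if "j \<le> p" for j
    using y[of "\<lambda>j. poly (q j) x0 / poly d x0", OF _ that] by blast
  have "\<forall>\<^sub>F x in at x0 within S. (\<forall>j\<le>p. poly (q j) x / poly d x > 0) \<longleftrightarrow> (\<forall>j\<le>p. poly (q j) x0 / poly d x0 > 0)" for S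
    by (intro eventually_positive_iff tendsto_divide poly_tendsto_within False nz)
  moreover have "\<not> aligned p A x0 J"
    using aligned_root False unfolding d by blast
  ultimately show thesis
    using that by blast
next
  case True
  have d0: "d \<noteq> 0" unfolding d by (rule char_poly_nonzero)
  let ?X = "[:- x0, 1:]"
  \<comment> \<open>By the hypothesis on \<open>y\<close>, a solution at \<open>x0\<close> would
    force a nonzero determinant; this absence of solutions produces the pole.\<close>
  have nosol: "\<nexists>v. \<forall>i\<le>p. x0 * v i - (\<Sum>j\<le>p. sg J i * A $$ (i, j) * v j) = sg J i * y i"
  proof
    assume "\<exists>v. \<forall>i\<le>p. x0 * v i - (\<Sum>j\<le>p. sg J i * A $$ (i, j) * v j) = sg J i * y i"
    then obtain v where v: "\<forall>i\<le>p. x0 * v i - (\<Sum>j\<le>p. sg J i * A $$ (i, j) * v j) = sg J i * y i"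
      by blast
    have "y i = (\<Sum>j\<le>p. v j * pick_shifted A x0 J j i)" if "i \<le> p" for i
      unfolding solution_iff_shifted[OF that] using v that by blast
    then have "det (cmat p (pick_shifted A x0 J)) \<noteq> 0"
      using y[of v 0] by blast
    then show False
      using True by (simp add: det_pick_shifted d)
  qed
  obtain k r e where q: "\<And>j. j \<le> p \<Longrightarrow> q j = ?X ^ k * r j" and de: "d = ?X ^ k * e"
    and e0: "poly e x0 = 0" and r0: "\<exists>j\<le>p. poly (r j) x0 \<noteq> 0"
    and sys': "\<And>i. i \<le> p \<Longrightarrow> [:0, 1:] * r i - (\<Sum>j\<le>p. Polynomial.smult (sg J i * A $$ (i, j)) (r j))
      = Polynomial.smult (sg J i * y i) e"
    using factor_out_root[OF sys d0 True nosol] by blast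
  have eigen: "signed_eigen p A x0 J (\<lambda>j. poly (r j) x0)"
    unfolding signed_eigen_def
  proof (intro allI impI)
    fix i assume i: "i \<le> p"
    have "poly ([:0, 1:] * r i - (\<Sum>j\<le>p. Polynomial.smult (sg J i * A $$ (i, j)) (r j))) x0 = 0"
      by (simp only: sys'[OF i] poly_smult e0 mult_zero_right)
    then show "x0 * poly (r i) x0 = sg J i * (\<Sum>j\<le>p. A $$ (i, j) * poly (r j) x0)"
      by (simp add: poly_sum sum_distrib_left mult.assoc)
  qed
  have quot: "poly (q j) x / poly d x = poly (r j) x / poly e x" if "j \<le> p" "x \<noteq> x0" for j x
    using that by (simp add: q de)
  show thesis
  proof (cases "aligned p A x0 J")
    case False
    have nonaligned: False if "\<forall>j\<le>p. 0 \<le> w j" "\<exists>j\<le>p. w j \<noteq> 0" "signed_eigen p A x0 J w" for w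
    proof -
      have "aligned p A x0 J"
        unfolding aligned_def by (intro exI[of _ w] conjI that)
      then show False using False by simp
    qed
    have "\<exists>j\<le>p. poly (r j) x0 > 0"
    proof (rule ccontr)
      assume "\<not> ?thesis"
      then have "\<forall>j\<le>p. 0 \<le> - poly (r j) x0" by force
      moreover have "signed_eigen p A x0 J (\<lambda>j. - poly (r j) x0)"
        using eigen by (simp add: signed_eigen_def sum_negf)
      moreover have "\<exists>j\<le>p. - poly (r j) x0 \<noteq> 0" using r0 by auto
      ultimately show False by (intro nonaligned)
    qed
    then obtain j1 where j1: "j1 \<le> p" "poly (r j1) x0 > 0" by blast
    have "\<exists>j\<le>p. poly (r j) x0 < 0"
      using nonaligned[OF _ r0 eigen] by (auto simp: not_less[symmetric])
    then obtain j2 where j2: "j2 \<le> p" "poly (r j2) x0 < 0" by blast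
    have "\<forall>\<^sub>F x in at x0 within S. (\<forall>j\<le>p. poly (q j) x / poly d x > 0) \<longleftrightarrow> False" for S
    proof -
      have "\<forall>\<^sub>F x in at x0 within S. poly (r j1) x > 0"
        using order_tendstoD(1)[OF poly_tendsto_within j1(2)] .
      moreover have "\<forall>\<^sub>F x in at x0 within S. poly (r j2) x < 0"
        using order_tendstoD(2)[OF poly_tendsto_within j2(2)] .
      moreover have "\<forall>\<^sub>F x in at x0 within S. x \<noteq> x0"
        by (simp add: eventually_at_filter)
      ultimately show ?thesis
      proof eventually_elim
        case (elim x)
        have "\<not> (poly (q j1) x / poly d x > 0 \<and> poly (q j2) x / poly d x > 0)"
          using elim by (auto simp: quot j1(1) j2(1) zero_less_divide_iff)
        then show ?case using j1(1) j2(1) by blast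
      qed
    qed
    then show thesis
      using that False by blast
  next
    case True
    then obtain u where u: "signed_eigen p A x0 J u" "\<forall>j\<le>p. 0 \<le> u j" "\<exists>j\<le>p. u j \<noteq> 0"
      unfolding aligned_def by blast
    then have upos: "\<And>j. j \<le> p \<Longrightarrow> 0 < u j"
      using strict[OF x0 J] by blast
    obtain \<kappa> where \<kappa>: "\<And>j. j \<le> p \<Longrightarrow> poly (r j) x0 = \<kappa> * u j"
      using eigenspace_line[OF x0 J u(1) upos eigen] by blast
    have \<kappa>0: "\<kappa> \<noteq> 0" using r0 \<kappa> by auto
    have e: "e \<noteq> 0" using d0 de by auto
    \<comment> \<open>The root of \<open>d\<close> is simple and \<open>e\<close> still vanishes at
      \<open>x0\<close>, so \<open>e\<close> carries the whole order and
      \<open>k = 0\<close>.\<close>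
    have "1 = Polynomial.order x0 d"
      using simple[OF x0 J True] by (simp add: d)
    also have "\<dots> = k + Polynomial.order x0 e"
      using d0 unfolding de by (simp add: order_mult order_power_n_n)
    finally have ord: "Polynomial.order x0 e = 1"
      using e0 e by (simp add: order_root)
    obtain g where g: "e = ?X ^ Polynomial.order x0 e * g" "\<not> ?X dvd g"
      using order_decomp[OF e, of x0] by blast
    have eg: "e = ?X * g" using g(1) ord by simp
    have g0: "poly g x0 \<noteq> 0" using g(2) by (simp add: poly_eq_0_iff_dvd)
    let ?v = "\<lambda>j. poly (r j) x0 / poly g x0"
    have v: "?v j \<noteq> 0" if "j \<le> p" for j
      using that \<kappa> \<kappa>0 upos[OF that] g0 by simp
    \<comment> \<open>Once \<open>x - x0\<close> is split off, the remaining quotient has the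
      nonzero limit \<open>?v j\<close>, so the side of \<open>x0\<close> decides the sign.\<close>
    have quot': "poly (q j) x / poly d x = (poly (r j) x / poly g x) / (x - x0)" if "j \<le> p" "x \<noteq> x0" for j x
    proof -
      have "poly e x = poly g x * (x - x0)" by (simp add: eg algebra_simps)
      then show ?thesis unfolding quot[OF that] by simp
    qed
    have "\<forall>\<^sub>F x in at_right x0. (\<forall>j\<le>p. poly (r j) x / poly g x > 0) \<longleftrightarrow> (\<forall>j\<le>p. ?v j > 0)"
      by (intro eventually_positive_iff tendsto_divide poly_tendsto_within g0 v)
    moreover have "\<forall>\<^sub>F x in at_right x0. x0 < x"
      by (simp add: eventually_at_filter)
    ultimately have 1: "\<forall>\<^sub>F x in at_right x0. (\<forall>j\<le>p. poly (q j) x / poly d x > 0) \<longleftrightarrow> (\<forall>j\<le>p. ?v j > 0)"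
    proof eventually_elim
      case (elim x)
      have "poly (q j) x / poly d x > 0 \<longleftrightarrow> poly (r j) x / poly g x > 0" if "j \<le> p" for j
      proof -
        have ne: "x \<noteq> x0" using elim(2) by simp
        show ?thesis
          unfolding quot'[OF that ne] zero_less_divide_iff[of _ "x - x0"] using elim(2) by simp
      qed
      then show ?case using elim(1) by simp
    qed
    have "\<forall>\<^sub>F x in at_left x0. (\<forall>j\<le>p. - (poly (r j) x / poly g x) > 0) \<longleftrightarrow> (\<forall>j\<le>p. - ?v j > 0)"
      by (intro eventually_positive_iff tendsto_minus tendsto_divide poly_tendsto_within g0) (use v in auto)
    moreover have "\<forall>\<^sub>F x in at_left x0. x < x0"
      by (simp add: eventually_at_filter)
    ultimately have 2: "\<forall>\<^sub>F x in at_left x0. (\<forall>j\<le>p. poly (q j) x / poly d x > 0) \<longleftrightarrow> (\<forall>j\<le>p. - ?v j > 0)"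
    proof eventually_elim
      case (elim x)
      have "poly (q j) x / poly d x > 0 \<longleftrightarrow> - (poly (r j) x / poly g x) > 0" if "j \<le> p" for j
      proof -
        have ne: "x \<noteq> x0" using elim(2) by simp
        show ?thesis
          unfolding quot'[OF that ne] zero_less_divide_iff[of _ "x - x0"] using elim(2) by simp
      qed
      then show ?case using elim(1) by simp
    qed
    have "?v j > 0 \<longleftrightarrow> \<kappa> / poly g x0 > 0" "- ?v j > 0 \<longleftrightarrow> \<kappa> / poly g x0 < 0" if "j \<le> p" for j
      using \<kappa>[OF that] upos[OF that]
      by (simp_all add: zero_less_divide_iff divide_less_0_iff zero_less_mult_iff mult_less_0_iff)
    then have "(\<forall>j\<le>p. - ?v j > 0) \<longleftrightarrow> \<kappa> / poly g x0 < 0" "(\<forall>j\<le>p. ?v j > 0) \<longleftrightarrow> \<kappa> / poly g x0 > 0"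
      by auto
    moreover have "\<kappa> / poly g x0 \<noteq> 0" using \<kappa>0 g0 by simp
    ultimately have "(\<forall>j\<le>p. - ?v j > 0) \<noteq> (\<forall>j\<le>p. ?v j > 0)"
      by (auto simp: not_less order_le_less)
    with 2 1 True show thesis
      using that by blast
  qed
qed

end

section \<open>The degree along the family\<close>

context generic_family
begin

abbreviation shifted_degree :: "real \<Rightarrow> int" where
  "shifted_degree x \<equiv> pldeg p (shifted A x) (shifted A (- x))"

text \<open>For \<open>x \<ge> 0\<close> counting signatures amounts to counting pairs, because an
  aligned signature has a single unit aligned vector.\<close>

definition mult_at :: "real \<Rightarrow> nat" where
  "mult_at x = card {J. J \<subseteq> {..p} \<and> aligned p A x J}"

definition aligned_values :: "real set" where
  "aligned_values = {x. \<exists>J\<subseteq>{..p}. aligned p A x J}"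

lemma finite_aligned_values: "finite aligned_values"
  unfolding aligned_values_def by (rule finite_aligned)

lemma nondeg_not_aligned:
  "x \<notin> aligned_values \<Longrightarrow> nondeg p (shifted A x) (shifted A (- x))"
  by (rule nondeg_shifted) (auto simp: aligned_values_def)

text \<open>One \<open>y\<close> serves both sides of \<open>x0\<close>. \<open>N\<close> and
  \<open>N'\<close> are the numbers of signatures with a positive solution on the left and on the
  right, and a signature belongs to exactly one of the two sets if and only if it is aligned at
  \<open>x0\<close>.\<close>

lemma degree_jump:
  assumes x0: "0 \<le> x0"
  obtains N N' :: int where
    "\<forall>\<^sub>F x in at_left x0. even (shifted_degree x - N)"
    "\<forall>\<^sub>F x in at_right x0. even (shifted_degree x - N')"
    "even (N - N' - int (mult_at x0))"
proof -
  let ?d = "\<lambda>J. char_poly (signed_mat p A J)"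
  have "finite (\<Union>J\<in>Pow {..p}. {x. poly (?d J) x = 0})"
    by (intro finite_UN_I poly_roots_finite char_poly_nonzero) simp
  \<comment> \<open>\<open>x1\<close> is an eigenvalue of none of the signed matrices. Genericity of
    \<open>y\<close> at \<open>x1\<close> shows that no numerator is the zero polynomial, so the
    zeros of the numerators are isolated.\<close>
  then obtain x1 where "x1 \<notin> (\<Union>J\<in>Pow {..p}. {x. poly (?d J) x = 0})"
    using ex_new_if_finite infinite_UNIV_char_0 by blast
  then have x1: "poly (?d J) x1 \<noteq> 0" if "J \<subseteq> {..p}" for J
    using that by blast
  let ?C = "(\<lambda>(x, J). pick_shifted A x J) ` ({x0, x1} \<times> Pow {..p})"
  have "finite ?C" by simp
  from generic_vector[OF this, of p] obtain y where y: "\<And>C v j. \<lbrakk>C \<in> ?C; \<And>i. i \<le> p \<Longrightarrow> y i = (\<Sum>j\<le>p. v j * C j i); j \<le> p\<rbrakk>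
    \<Longrightarrow> det (cmat p C) \<noteq> 0 \<and> v j \<noteq> 0"
    by blast
  define sys where "sys J q \<longleftrightarrow> (\<forall>i\<le>p. [:0, 1:] * q i
      - (\<Sum>j\<le>p. Polynomial.smult (sg J i * A $$ (i, j)) (q j)) = Polynomial.smult (sg J i * y i) (?d J))" for J q
  have "\<exists>q. sys J q" for J
  proof -
    obtain q where "\<And>i. i < Suc p \<Longrightarrow> [:0, 1:] * q i
        - (\<Sum>j<Suc p. Polynomial.smult (signed_mat p A J $$ (i, j)) (q j)) = Polynomial.smult (sg J i * y i) (?d J)"
      using char_poly_solution[OF signed_mat_carrier[of p A J], where c = "\<lambda>i. sg J i * y i"] by blast
    moreover have "(\<Sum>j<Suc p. Polynomial.smult (signed_mat p A J $$ (i, j)) (q j))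
        = (\<Sum>j\<le>p. Polynomial.smult (sg J i * A $$ (i, j)) (q j))" if "i \<le> p" for i
      unfolding lessThan_Suc_atMost using that by (intro sum.cong) (auto simp: signed_mat_def)
    ultimately have "sys J q"
      unfolding sys_def by (simp only: less_Suc_eq_le) simp
    then show ?thesis by blast
  qed
  then have "\<exists>q. \<forall>J. sys J (q J)"
    by (intro choice allI)
  then obtain q where q: "\<And>J. sys J (q J)"
    by blast
  have solves: "y i = (\<Sum>j\<le>p. poly (q J j) x / poly (?d J) x * pick_shifted A x J j i)"
    if i: "i \<le> p" and nz: "poly (?d J) x \<noteq> 0" for i J x
  proof -
    have "poly ([:0, 1:] * q J i - (\<Sum>j\<le>p. Polynomial.smult (sg J i * A $$ (i, j)) (q J j))) x
        = sg J i * y i * poly (?d J) x"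
      using q[of J] i by (simp only: sys_def poly_smult)
    then have "(x * poly (q J i) x - (\<Sum>j\<le>p. sg J i * A $$ (i, j) * poly (q J j) x)) / poly (?d J) x = sg J i * y i"
      using nz by (simp add: poly_sum)
    then have "x * (poly (q J i) x / poly (?d J) x)
        - (\<Sum>j\<le>p. sg J i * A $$ (i, j) * (poly (q J j) x / poly (?d J) x)) = sg J i * y i"
      by (simp add: diff_divide_distrib sum_divide_distrib)
    then show ?thesis
      unfolding solution_iff_shifted[OF i, where v = "\<lambda>j. poly (q J j) x / poly (?d J) x"] .
  qed
  have q0: "q J j \<noteq> 0" if J: "J \<subseteq> {..p}" and j: "j \<le> p" for J j
  proof -
    have "pick_shifted A x1 J \<in> ?C" using J by force
    then have "poly (q J j) x1 / poly (?d J) x1 \<noteq> 0"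
      using y[OF _ solves[OF _ x1[OF J]] j] by blast
    then show ?thesis by auto
  qed
  let ?pos = "\<lambda>J x. \<forall>j\<le>p. poly (q J j) x / poly (?d J) x > 0"
  let ?R = "\<lambda>J b c. (\<forall>\<^sub>F x in at_left x0. ?pos J x \<longleftrightarrow> b) \<and> (\<forall>\<^sub>F x in at_right x0. ?pos J x \<longleftrightarrow> c)
      \<and> (b \<noteq> c \<longleftrightarrow> aligned p A x0 J)"
  have "\<exists>bc. ?R J (fst bc) (snd bc)" if J: "J \<in> Pow {..p}" for J
  proof -
    have J': "J \<subseteq> {..p}" using J by simp
    have "pick_shifted A x0 J \<in> ?C" using J by force
    note yJ = y[OF this]
    show ?thesis
    proof (rule sign_jump[OF x0 J', where q = "q J" and y = y and d = "?d J"])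
      show "det (cmat p (pick_shifted A x0 J)) \<noteq> 0 \<and> v j \<noteq> 0"
        if "\<And>i. i \<le> p \<Longrightarrow> y i = (\<Sum>j\<le>p. v j * pick_shifted A x0 J j i)" "j \<le> p" for v j
        using that by (rule yJ)
    next
      show "[:0, 1:] * q J i - (\<Sum>j\<le>p. Polynomial.smult (sg J i * A $$ (i, j)) (q J j))
          = Polynomial.smult (sg J i * y i) (?d J)" if "i \<le> p" for i
        using q[of J] that by (simp only: sys_def)
    next
      show "?d J = char_poly (signed_mat p A J)" ..
    next
      fix b c
      assume "\<forall>\<^sub>F x in at_left x0. ?pos J x \<longleftrightarrow> b" "\<forall>\<^sub>F x in at_right x0. ?pos J x \<longleftrightarrow> c"
        "b \<noteq> c \<longleftrightarrow> aligned p A x0 J"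
      then show ?thesis by (intro exI[of _ "(b, c)"]) simp
    qed
  qed
  then have "\<exists>bc. \<forall>J\<in>Pow {..p}. ?R J (fst (bc J)) (snd (bc J))"
    by (intro bchoice ballI)
  then obtain bc where bc: "\<And>J. J \<in> Pow {..p} \<Longrightarrow> ?R J (fst (bc J)) (snd (bc J))"
    by blast
  define b c where "b J = fst (bc J)" and "c J = snd (bc J)" for J
  from bc have b: "\<And>J. J \<in> Pow {..p} \<Longrightarrow> \<forall>\<^sub>F x in at_left x0. ?pos J x \<longleftrightarrow> b J"
    and c: "\<And>J. J \<in> Pow {..p} \<Longrightarrow> \<forall>\<^sub>F x in at_right x0. ?pos J x \<longleftrightarrow> c J"
    and bc: "\<And>J. J \<in> Pow {..p} \<Longrightarrow> b J \<noteq> c J \<longleftrightarrow> aligned p A x0 J"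
    unfolding b_def c_def by blast+
  \<comment> \<open>Near \<open>x0\<close>, but not at it, all denominators and numerators are
    nonzero, so the parity formula applies to \<open>y\<close>.\<close>
  have regular: "\<forall>\<^sub>F x in at x0 within S. even (shifted_degree x - int (card {J. J \<subseteq> {..p} \<and> s J}))"
    if s: "\<And>J. J \<in> Pow {..p} \<Longrightarrow> \<forall>\<^sub>F x in at x0 within S. ?pos J x \<longleftrightarrow> s J" for S s
  proof -
    have "\<forall>\<^sub>F x in at x0 within S. \<forall>J\<in>Pow {..p}. ?pos J x \<longleftrightarrow> s J"
      using s by (intro eventually_ball_finite) auto
    moreover have "\<forall>\<^sub>F x in at x0 within S. \<forall>J\<in>Pow {..p}. poly (?d J) x \<noteq> 0"
      by (intro eventually_ball_finite ballI poly_eventually_nonzero char_poly_nonzero) auto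
    moreover have "\<forall>\<^sub>F x in at x0 within S. \<forall>J\<in>Pow {..p}. \<forall>j\<in>{..p}. poly (q J j) x \<noteq> 0"
      by (intro eventually_ball_finite ballI poly_eventually_nonzero q0) auto
    ultimately show ?thesis
    proof eventually_elim
      case (elim x)
      interpret regular_value p "shifted A x" "shifted A (- x)" y "\<lambda>J j. poly (q J j) x / poly (?d J) x"
      proof
        fix J assume J: "J \<subseteq> {..p}"
        show "det (cmat p (pick_shifted A x J)) \<noteq> 0"
          using elim(2) J by (simp add: det_pick_shifted)
        show "y i = (\<Sum>j\<le>p. poly (q J j) x / poly (?d J) x * pick_shifted A x J j i)" if "i \<le> p" for i
          using elim(2) J by (intro solves that) auto
        show "poly (q J j) x / poly (?d J) x \<noteq> 0" if "j \<le> p" for j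
          using elim(2,3) J that by auto
      qed
      have "{J. J \<subseteq> {..p} \<and> ?pos J x} = {J. J \<subseteq> {..p} \<and> s J}"
        using elim(1) by blast
      then show ?case
        using pldeg_parity by simp
    qed
  qed
  let ?count = "\<lambda>s. card {J. J \<subseteq> {..p} \<and> s J}"
  have count: "int (?count s) = (\<Sum>J\<in>Pow {..p}. if s J then 1 else 0)" for s
  proof -
    have "{J. J \<subseteq> {..p} \<and> s J} = {J \<in> Pow {..p}. s J}" by auto
    then show ?thesis by (simp add: sum.If_cases Int_def)
  qed
  have "int (?count b) - int (?count c) - int (mult_at x0)
      = (\<Sum>J\<in>Pow {..p}. (if b J then 1 else 0) - (if c J then 1 else 0) - (if aligned p A x0 J then 1 else 0))"
    unfolding mult_at_def count by (simp only: sum_subtractf)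
  moreover have "even \<dots>"
    by (rule dvd_sum) (use bc in auto)
  ultimately have jump: "even (int (?count b) - int (?count c) - int (mult_at x0))"
    by simp
  show thesis
    by (rule that[OF regular[where s = b, OF b] regular[where s = c, OF c] jump])
qed

lemma shifted_degree_constant:
  assumes "a \<le> b" "{a..b} \<inter> aligned_values = {}"
  shows "shifted_degree a = shifted_degree b"
proof (rule pldeg_homotopy)
  fix t :: real assume t: "0 \<le> t" "t \<le> 1"
  let ?x = "(1 - t) * a + t * b"
  have "?x \<in> {a..b}"
    using t assms(1) convex_bound_le[of a b b "1 - t" t] convex_bound_le[of "-a" "-a" "-b" "1 - t" t]
    by (auto simp: algebra_simps)
  then have "nondeg p (shifted A ?x) (shifted A (- ?x))"
    using assms(2) by (intro nondeg_not_aligned) blast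
  moreover have "shifted A ?x = (\<lambda>j i. (1 - t) * shifted A a j i + t * shifted A b j i)"
    "shifted A (- ?x) = (\<lambda>j i. (1 - t) * shifted A (- a) j i + t * shifted A (- b) j i)"
    by (auto simp: shifted_def fun_eq_iff algebra_simps)
  ultimately show "nondeg p (\<lambda>j i. (1 - t) * shifted A a j i + t * shifted A b j i)
      (\<lambda>j i. (1 - t) * shifted A (- a) j i + t * shifted A (- b) j i)"
    by simp
qed

text \<open>\<open>(1 - t) (a z - A |z|) + t z\<close> is \<open>1 - t\<close> times the member of
  the family at \<open>a + t / (1 - t)\<close>. The homotopy to the identity thus runs through the
  parameters from \<open>a\<close> to infinity, none of them aligned.\<close>

lemma shifted_degree_eq_1:
  assumes "0 \<le> a" "{a..} \<inter> aligned_values = {}"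
  shows "shifted_degree a = 1"
proof -
  define I :: "nat \<Rightarrow> nat \<Rightarrow> real" where "I j i = (if i = j then 1 else 0)" for j i
  have "cmat p I = 1\<^sub>m (Suc p)" by (auto simp: cmat_def I_def)
  then have I: "det (cmat p I) \<noteq> 0" by simp
  have "shifted_degree a = lindeg p I"
  proof (rule pldeg_homotopy)
    fix t :: real assume t: "0 \<le> t" "t \<le> 1"
    let ?P = "\<lambda>j i. (1 - t) * shifted A a j i + t * I j i"
      and ?Q = "\<lambda>j i. (1 - t) * shifted A (- a) j i + t * - I j i"
    show "nondeg p ?P ?Q"
    proof (cases "t = 1")
      case True
      then show ?thesis using nondeg_linear[OF I] by simp
    next
      case False
      then have t1: "1 - t > 0" using t by simp
      let ?x = "a + t / (1 - t)"
      have "?x \<ge> a" using t t1 by simp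
      then have nd: "nondeg p (shifted A ?x) (shifted A (- ?x))"
        using assms(2) by (intro nondeg_not_aligned) (auto simp: disjoint_iff)
      have "?P = (\<lambda>j i. (1 - t) * shifted A ?x j i)" "?Q = (\<lambda>j i. (1 - t) * shifted A (- ?x) j i)"
        using t1 by (auto simp: shifted_def I_def fun_eq_iff field_simps)
      then have "plmap p ?P ?Q z i = (1 - t) * plmap p (shifted A ?x) (shifted A (- ?x)) z i" for z i
        by (simp add: plmap_def sum_distrib_left algebra_simps)
      then show ?thesis
        using nd t1 by (simp add: nondeg_def)
    qed
  qed
  also have "\<dots> = 1"
    by (rule lindeg_id) (simp add: I_def)
  finally show ?thesis .
qed

lemma shifted_degree_eq_0:
  assumes "0 \<le> a" "{0..a} \<inter> aligned_values = {}"
  shows "shifted_degree a = 0"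
proof -
  have "shifted_degree 0 = 0"
    using assms by (intro pldeg_equal_columns[of 0] nondeg_not_aligned) auto
  then show ?thesis
    using shifted_degree_constant[OF assms] by simp
qed

text \<open>Each induction step crosses only the least aligned value \<open>z\<close> above
  \<open>a\<close>: the degree is constant up to a point left of \<open>z\<close>, the crossing
  changes it by \<open>mult_at z\<close> modulo 2, and \<open>b\<close> is chosen between
  \<open>z\<close> and the next aligned value. Beyond the last one the degree is 1.\<close>

lemma shifted_degree_parity:
  assumes "0 \<le> a" "a \<notin> aligned_values"
  shows "even (shifted_degree a - 1 - (\<Sum>x\<in>{x \<in> aligned_values. a < x}. int (mult_at x)))"
  using assms
proof (induction "card {x \<in> aligned_values. a < x}" arbitrary: a rule: less_induct)
  case less
  let ?Z = "\<lambda>a. {x \<in> aligned_values. a < x}"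
  have fin: "finite (?Z a)" for a using finite_aligned_values by simp
  show ?case
  proof (cases "?Z a = {}")
    case True
    then have "{a..} \<inter> aligned_values = {}"
      using less.prems(2) by (auto simp: order_le_less)
    then have "shifted_degree a = 1"
      using less.prems(1) by (intro shifted_degree_eq_1)
    then show ?thesis
      unfolding True by simp
  next
    case False
    define z where "z = Min (?Z a)"
    have z: "z \<in> ?Z a" "\<And>x. x \<in> ?Z a \<Longrightarrow> z \<le> x"
      unfolding z_def using Min_in[OF fin False] Min_le[OF fin] by blast+
    have z0: "0 \<le> z" using z(1) less.prems(1) by simp
    obtain N N' where N: "\<forall>\<^sub>F x in at_left z. even (shifted_degree x - N)"
      and N': "\<forall>\<^sub>F x in at_right z. even (shifted_degree x - N')"
      and NN: "even (N - N' - int (mult_at z))"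
      using degree_jump[OF z0] by blast
    have "\<forall>\<^sub>F x in at_left z. x \<in> {a<..<z}"
      using z(1) by (intro eventually_at_leftI[of a]) auto
    then have "\<exists>x. x \<in> {a<..<z} \<and> even (shifted_degree x - N)"
      by (rule eventually_happens'[OF trivial_limit_at_left_real eventually_conj[OF _ N]])
    then obtain x where x: "a < x" "x < z" "even (shifted_degree x - N)" by auto
    have "{a..x} \<inter> aligned_values = {}"
      using x(2) z(2) less.prems(2) by (force simp: order_le_less)
    then have "shifted_degree a = shifted_degree x"
      using x(1) by (intro shifted_degree_constant) auto
    then have 1: "even (shifted_degree a - N)" using x(3) by simp
    have "\<forall>\<^sub>F x in at_right z. \<forall>w\<in>?Z a - {z}. x < w"
    proof (intro eventually_ball_finite ballI)
      fix w assume "w \<in> ?Z a - {z}"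
      then have "z < w" using z(2) by force
      then show "\<forall>\<^sub>F x in at_right z. x < w"
        by (intro eventually_at_rightI[of z w]) auto
    qed (use fin in auto)
    moreover have "\<forall>\<^sub>F x in at_right z. z < x"
      by (simp add: eventually_at_filter)
    ultimately have "\<forall>\<^sub>F x in at_right z. (\<forall>w\<in>?Z a - {z}. x < w) \<and> z < x"
      by (rule eventually_conj)
    then have "\<exists>x. ((\<forall>w\<in>?Z a - {z}. x < w) \<and> z < x) \<and> even (shifted_degree x - N')"
      by (rule eventually_happens'[OF trivial_limit_at_right_real eventually_conj[OF _ N']])
    then obtain b where b: "z < b" "\<And>w. w \<in> ?Z a - {z} \<Longrightarrow> b < w" "even (shifted_degree b - N')" by blast
    have ab: "a < b" using z(1) b(1) by simp
    have Z: "?Z b = ?Z a - {z}"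
      using b(1,2) ab by auto
    have bn: "b \<notin> aligned_values"
      using b(1) b(2)[of b] ab by auto
    have "card (?Z b) < card (?Z a)"
      unfolding Z using fin z(1) by (intro psubset_card_mono) auto
    then have IH: "even (shifted_degree b - 1 - (\<Sum>x\<in>?Z b. int (mult_at x)))"
      using less.hyps bn ab less.prems(1) by simp
    have "(\<Sum>x\<in>?Z a. int (mult_at x)) = int (mult_at z) + (\<Sum>x\<in>?Z b. int (mult_at x))"
      unfolding Z using fin z(1) by (rule sum.remove)
    then show ?thesis
      using IH 1 NN b(3) by presburger
  qed
qed

end

section \<open>The LCP map\<close>

definition sign_matrix :: "nat \<Rightarrow> nat set \<Rightarrow> real mat" where
  "sign_matrix p J = mat (Suc p) (Suc p) (\<lambda>(i, j). if i = j then sg J i else 0)"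

lemma sign_matrix_carrier [simp]: "sign_matrix p J \<in> carrier_mat (Suc p) (Suc p)"
  by (simp add: sign_matrix_def)

lemma signature_mats_eq: "signature_mats (Suc p) = sign_matrix p ` Pow {..p}"
proof (intro equalityI subsetI)
  fix S assume S: "S \<in> signature_mats (Suc p)"
  then have "S \<in> carrier_mat (Suc p) (Suc p)" "diagonal_mat S"
    and d: "\<And>i. i \<le> p \<Longrightarrow> S $$ (i, i) \<in> {-1, 1}"
    by (auto simp: signature_mats_def less_Suc_eq_le)
  then have "S = sign_matrix p {j. j \<le> p \<and> S $$ (j, j) = -1}"
    by (intro eq_matI) (auto simp: sign_matrix_def sg_def diagonal_mat_def less_Suc_eq_le)
  then show "S \<in> sign_matrix p ` Pow {..p}" by blast
next
  fix S assume "S \<in> sign_matrix p ` Pow {..p}"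
  then show "S \<in> signature_mats (Suc p)"
    by (auto simp: signature_mats_def sign_matrix_def diagonal_mat_def sg_def split: if_splits)
qed

lemma inj_on_sign_matrix: "inj_on (sign_matrix p) (Pow {..p})"
proof (rule inj_on_inverseI)
  fix J assume "J \<in> Pow {..p}"
  then show "{j. j \<le> p \<and> sign_matrix p J $$ (j, j) = -1} = J"
    by (auto simp: sign_matrix_def sg_def split: if_splits)
qed

lemma sign_matrix_mult_vec:
  assumes "v \<in> carrier_vec (Suc p)"
  shows "sign_matrix p J *\<^sub>v v = vec (Suc p) (\<lambda>i. sg J i * v $ i)"
  using assms by (intro eq_vecI)
    (auto simp: sign_matrix_def scalar_prod_def if_distrib[where f = "\<lambda>x. x * _"] cong: if_cong)

lemma sign_matrix_mult:
  assumes "A \<in> carrier_mat (Suc p) (Suc p)"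
  shows "sign_matrix p J * A = signed_mat p A J"
  using assms by (intro eq_matI)
    (auto simp: sign_matrix_def signed_mat_def scalar_prod_def if_distrib[where f = "\<lambda>x. x * _"] cong: if_cong)

lemma mult_mat_vec_index:
  assumes "A \<in> carrier_mat (Suc p) (Suc p)" "v \<in> carrier_vec (Suc p)" "i \<le> p"
  shows "(A *\<^sub>v v) $ i = (\<Sum>j\<le>p. A $$ (i, j) * v $ j)"
  using assms by (simp add: scalar_prod_def atLeast0LessThan lessThan_Suc_atMost)

lemma unit_nonneg_vecs_iff:
  "v \<in> unit_nonneg_vecs (Suc p) \<longleftrightarrow>
    v \<in> carrier_vec (Suc p) \<and> (\<forall>i\<le>p. 0 \<le> v $ i) \<and> (\<Sum>i\<le>p. (v $ i)\<^sup>2) = 1"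
  by (auto simp: unit_nonneg_vecs_def vnorm2_def less_Suc_eq_le lessThan_Suc_atMost)

lemma unit_nonneg_nonzero:
  assumes "v \<in> unit_nonneg_vecs (Suc p)"
  shows "\<exists>i\<le>p. v $ i \<noteq> 0"
proof -
  have "(\<Sum>i\<le>p. (v $ i)\<^sup>2) > 0"
    using assms by (simp add: unit_nonneg_vecs_iff)
  then show ?thesis by (simp add: sum_squares_pos_iff)
qed

lemma normalize_nonneg:
  assumes "\<forall>j\<le>p. 0 \<le> u j" "\<exists>j\<le>p. u j \<noteq> 0"
  obtains r where "r > 0" "vec (Suc p) (\<lambda>i. u i / r) \<in> unit_nonneg_vecs (Suc p)"
proof -
  let ?s = "\<Sum>j\<le>p. (u j)\<^sup>2"
  have s: "?s > 0" using assms(2) by (simp add: sum_squares_pos_iff)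
  have "(\<Sum>i\<le>p. (u i / sqrt ?s)\<^sup>2) = (\<Sum>i\<le>p. (u i)\<^sup>2 / ?s)"
    using s by (intro sum.cong) (auto simp: power_divide)
  also have "\<dots> = 1" using s by (simp flip: sum_divide_distrib)
  finally have "(\<Sum>i\<le>p. (u i / sqrt ?s)\<^sup>2) = 1" .
  then have "vec (Suc p) (\<lambda>i. u i / sqrt ?s) \<in> unit_nonneg_vecs (Suc p)"
    using s assms(1) by (simp add: unit_nonneg_vecs_iff)
  then show thesis using s by (intro that) auto
qed

lemma signed_eigen_scale:
  assumes "signed_eigen p A x J u"
  shows "signed_eigen p A x J (\<lambda>i. u i / r)"
  using assms unfolding signed_eigen_def by (simp add: divide_inverse flip: sum_distrib_right mult.assoc)

lemma signed_eigen_cong: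
  assumes "\<And>i. i \<le> p \<Longrightarrow> u i = w i"
  shows "signed_eigen p A x J u \<longleftrightarrow> signed_eigen p A x J w"
proof -
  have "(\<Sum>j\<le>p. A $$ (i, j) * u j) = (\<Sum>j\<le>p. A $$ (i, j) * w j)" for i
    using assms by (intro sum.cong) auto
  then show ?thesis
    using assms by (simp add: signed_eigen_def)
qed

lemma aligned_iff_unit:
  "aligned p A x J \<longleftrightarrow> (\<exists>v \<in> unit_nonneg_vecs (Suc p). signed_eigen p A x J (($) v))"
proof
  assume "aligned p A x J"
  then obtain u where u: "\<forall>j\<le>p. 0 \<le> u j" "\<exists>j\<le>p. u j \<noteq> 0" "signed_eigen p A x J u"
    unfolding aligned_def by blast
  obtain r where r: "vec (Suc p) (\<lambda>i. u i / r) \<in> unit_nonneg_vecs (Suc p)"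
    using normalize_nonneg[OF u(1,2)] by blast
  have "signed_eigen p A x J (($) (vec (Suc p) (\<lambda>i. u i / r))) \<longleftrightarrow> signed_eigen p A x J (\<lambda>i. u i / r)"
    by (rule signed_eigen_cong) simp
  then show "\<exists>v \<in> unit_nonneg_vecs (Suc p). signed_eigen p A x J (($) v)"
    using r signed_eigen_scale[OF u(3)] by blast
next
  assume "\<exists>v \<in> unit_nonneg_vecs (Suc p). signed_eigen p A x J (($) v)"
  then obtain v where v: "v \<in> unit_nonneg_vecs (Suc p)" "signed_eigen p A x J (($) v)" by blast
  then show "aligned p A x J"
    unfolding aligned_def using unit_nonneg_nonzero[OF v(1)]
    by (intro exI[of _ "($) v"]) (simp add: unit_nonneg_vecs_iff)
qed

lemma generic_mat_imp_generic_family: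
  assumes A: "A \<in> carrier_mat (Suc p) (Suc p)" and gen: "generic_mat (Suc p) A"
  shows "generic_family p A"
proof -
  have *: "simple_eigenvalue (signed_mat p A J) x \<and> (\<forall>i\<le>p. 0 < v $ i)"
    if x: "0 \<le> x" and J: "J \<subseteq> {..p}" and v: "v \<in> unit_nonneg_vecs (Suc p)" and e: "signed_eigen p A x J (($) v)"
    for x J v
  proof -
    have "(sign_matrix p J * A) *\<^sub>v v = x \<cdot>\<^sub>v v"
      unfolding sign_matrix_mult[OF A] using v e
      by (simp add: signed_eigen_iff_mult unit_nonneg_vecs_iff)
    moreover have "sign_matrix p J \<in> signature_mats (Suc p)"
      using J by (auto simp: signature_mats_eq)
    ultimately have "simple_eigenvalue (sign_matrix p J * A) x \<and> (\<forall>i<Suc p. 0 < v $ i)"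
      using gen x v unfolding generic_mat_def by blast
    then show ?thesis
      unfolding sign_matrix_mult[OF A] by (simp add: less_Suc_eq_le)
  qed
  show ?thesis
  proof
    fix x J u i
    assume x: "0 \<le> x" and J: "J \<subseteq> {..p}" and e: "signed_eigen p A x J u"
      and u: "\<forall>j\<le>p. 0 \<le> u j" "\<exists>j\<le>p. u j \<noteq> 0" and i: "i \<le> p"
    obtain r where r: "r > 0" "vec (Suc p) (\<lambda>i. u i / r) \<in> unit_nonneg_vecs (Suc p)"
      using normalize_nonneg[OF u] by blast
    have "signed_eigen p A x J (($) (vec (Suc p) (\<lambda>i. u i / r))) \<longleftrightarrow> signed_eigen p A x J (\<lambda>i. u i / r)"
      by (rule signed_eigen_cong) simp
    then have "0 < vec (Suc p) (\<lambda>i. u i / r) $ i"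
      using *[OF x J r(2)] signed_eigen_scale[OF e] i by blast
    then show "0 < u i"
      using r(1) i by (simp add: zero_less_divide_iff)
  next
    fix x J
    assume "0 \<le> x" "J \<subseteq> {..p}" "aligned p A x J"
    then have "simple_eigenvalue (signed_mat p A J) x"
      using * unfolding aligned_iff_unit by blast
    then show "Polynomial.order x (char_poly (signed_mat p A J)) = 1"
      by (simp add: simple_eigenvalue_def)
  qed
qed

section \<open>The family attached to an LCP-generic matrix\<close>

locale lcp_generic_matrix =
  fixes p :: nat and M N :: "real mat"
  assumes M: "M \<in> carrier_mat (Suc p) (Suc p)" and N: "N \<in> carrier_mat (Suc p) (Suc p)"
    and right_inverse: "(M + 1\<^sub>m (Suc p)) * N = 1\<^sub>m (Suc p)"
    and left_inverse: "N * (M + 1\<^sub>m (Suc p)) = 1\<^sub>m (Suc p)"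
    and generic: "generic_mat (Suc p) (N * (M - 1\<^sub>m (Suc p)))"
begin

abbreviation B :: "real mat" where "B \<equiv> M + 1\<^sub>m (Suc p)"

definition A :: "real mat" where "A = N * (M - 1\<^sub>m (Suc p))"

lemma A_carrier: "A \<in> carrier_mat (Suc p) (Suc p)"
  unfolding A_def using N M by (meson minus_carrier_mat mult_carrier_mat one_carrier_mat)

lemma B_carrier: "B \<in> carrier_mat (Suc p) (Suc p)"
  using M by simp

lemma minus_one_eq: "M - 1\<^sub>m (Suc p) = B * A"
proof -
  have "B * A = (B * N) * (M - 1\<^sub>m (Suc p))"
    unfolding A_def using M by (intro assoc_mult_mat[symmetric, OF B_carrier N]) auto
  then show ?thesis
    unfolding right_inverse using M by (simp add: left_mult_one_mat minus_carrier_mat)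
qed

lemma B_cancel:
  assumes "u \<in> carrier_vec (Suc p)" "w \<in> carrier_vec (Suc p)"
  shows "B *\<^sub>v u = B *\<^sub>v w \<longleftrightarrow> u = w"
proof
  assume "B *\<^sub>v u = B *\<^sub>v w"
  then have "(N * B) *\<^sub>v u = (N * B) *\<^sub>v w"
    using assms by (simp only: assoc_mult_mat_vec[OF N B_carrier])
  then show "u = w"
    unfolding left_inverse using assms by simp
qed simp

lemma det_B: "det B \<noteq> 0"
proof
  assume "det B = 0"
  then have "det (B * N) = 0"
    by (simp add: det_mult[OF B_carrier N])
  then show False
    unfolding right_inverse by simp
qed

sublocale generic_family p A
  using A_carrier generic unfolding A_def by (rule generic_mat_imp_generic_family)

text \<open>As \<open>M - 1 = B A\<close> and \<open>B\<close> is injective, \<open>B\<close>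
  cancels from the trio equation and leaves \<open>A v = l S v\<close>; since \<open>S\<close> is
  its own inverse, this is the eigenvector equation for \<open>S A\<close>.\<close>

lemma trio_iff:
  assumes J: "J \<subseteq> {..p}"
  shows "(l, sign_matrix p J, v) \<in> lcp_aligned_trios (Suc p) M \<longleftrightarrow>
    0 \<le> l \<and> v \<in> unit_nonneg_vecs (Suc p) \<and> signed_eigen p A l J (($) v)"
proof (cases "v \<in> unit_nonneg_vecs (Suc p)")
  case True
  then have v: "v \<in> carrier_vec (Suc p)" by (simp add: unit_nonneg_vecs_iff)
  let ?S = "sign_matrix p J"
  have S: "sign_matrix p J \<in> signature_mats (Suc p)"
    using J by (auto simp: signature_mats_eq)
  have Sv: "?S *\<^sub>v v \<in> carrier_vec (Suc p)"
    by (rule mult_mat_vec_carrier[OF sign_matrix_carrier v])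
  have Av: "A *\<^sub>v v \<in> carrier_vec (Suc p)"
    by (rule mult_mat_vec_carrier[OF A_carrier v])
  have "(M - 1\<^sub>m (Suc p)) *\<^sub>v v = B *\<^sub>v (A *\<^sub>v v)"
    unfolding minus_one_eq by (rule assoc_mult_mat_vec[OF B_carrier A_carrier v])
  moreover have "l \<cdot>\<^sub>v (B *\<^sub>v (?S *\<^sub>v v)) = B *\<^sub>v (l \<cdot>\<^sub>v (?S *\<^sub>v v))"
    by (rule mult_mat_vec[OF B_carrier Sv, symmetric])
  ultimately have "(M - 1\<^sub>m (Suc p)) *\<^sub>v v = l \<cdot>\<^sub>v (B *\<^sub>v (?S *\<^sub>v v)) \<longleftrightarrow> A *\<^sub>v v = l \<cdot>\<^sub>v (?S *\<^sub>v v)"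
    using B_cancel[OF Av, of "l \<cdot>\<^sub>v (?S *\<^sub>v v)"] Sv by simp
  also have "\<dots> \<longleftrightarrow> (\<forall>i\<le>p. (A *\<^sub>v v) $ i = l * (sg J i * v $ i))"
    using Av v carrier_matD(1)[OF A_carrier] unfolding sign_matrix_mult_vec[OF v] by (auto simp: vec_eq_iff less_Suc_eq_le)
  also have "\<dots> \<longleftrightarrow> signed_eigen p A l J (($) v)"
  proof -
    have "r = l * (sg J i * t) \<longleftrightarrow> l * t = sg J i * r" for r t i
      by (auto simp: sg_def)
    then show ?thesis
      unfolding signed_eigen_def by (simp add: mult_mat_vec_index[OF A_carrier v])
  qed
  finally show ?thesis
    using True S by (simp add: lcp_aligned_trios_def)
qed (auto simp: lcp_aligned_trios_def)

lemma trio_sign_matrix: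
  assumes "(l, S, v) \<in> lcp_aligned_trios (Suc p) M"
  obtains J where "J \<subseteq> {..p}" "S = sign_matrix p J"
  using assms by (auto simp: lcp_aligned_trios_def signature_mats_eq)

lemma spec_eq: "lcp_aligned_spec (Suc p) M = {l \<in> aligned_values. 0 \<le> l}"
proof (intro equalityI subsetI)
  fix l assume "l \<in> lcp_aligned_spec (Suc p) M"
  then obtain S v where t: "(l, S, v) \<in> lcp_aligned_trios (Suc p) M"
    by (auto simp: lcp_aligned_spec_def)
  then obtain J where "J \<subseteq> {..p}" "S = sign_matrix p J"
    by (rule trio_sign_matrix)
  then show "l \<in> {l \<in> aligned_values. 0 \<le> l}"
    using t trio_iff by (auto simp: aligned_values_def aligned_iff_unit)
next
  fix l assume "l \<in> {l \<in> aligned_values. 0 \<le> l}"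
  then obtain J v where "J \<subseteq> {..p}" "0 \<le> l" "v \<in> unit_nonneg_vecs (Suc p)" "signed_eigen p A l J (($) v)"
    by (auto simp: aligned_values_def aligned_iff_unit)
  then have "(l, sign_matrix p J, v) \<in> lcp_aligned_trios (Suc p) M"
    using trio_iff by blast
  then show "l \<in> lcp_aligned_spec (Suc p) M"
    unfolding lcp_aligned_spec_def by blast
qed

text \<open>The eigenspace is a line, equal length leaves the factors 1 and -1, and the entry at
  index 0 excludes -1.\<close>

lemma unit_eigenvector_unique:
  assumes l: "0 \<le> l" and J: "J \<subseteq> {..p}"
    and v: "v \<in> unit_nonneg_vecs (Suc p)" "signed_eigen p A l J (($) v)"
    and w: "w \<in> unit_nonneg_vecs (Suc p)" "signed_eigen p A l J (($) w)"
  shows "w = v"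
proof -
  have vpos: "0 < v $ i" if "i \<le> p" for i
    using strict[OF l J v(2) _ unit_nonneg_nonzero[OF v(1)] that] v(1) by (simp add: unit_nonneg_vecs_iff)
  obtain \<kappa> where \<kappa>: "\<And>j. j \<le> p \<Longrightarrow> w $ j = \<kappa> * v $ j"
    using eigenspace_line[OF l J v(2) vpos w(2)] by blast
  have "1 = (\<Sum>i\<le>p. (w $ i)\<^sup>2)"
    using w(1) by (simp add: unit_nonneg_vecs_iff)
  also have "\<dots> = \<kappa>\<^sup>2 * (\<Sum>i\<le>p. (v $ i)\<^sup>2)"
    unfolding sum_distrib_left by (intro sum.cong) (auto simp: \<kappa> power_mult_distrib)
  also have "\<dots> = \<kappa>\<^sup>2"
    using v(1) by (simp add: unit_nonneg_vecs_iff)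
  finally have "\<kappa> = 1 \<or> \<kappa> = -1"
    by (metis power2_eq_1_iff)
  moreover have "0 \<le> \<kappa> * v $ 0"
    unfolding \<kappa>[OF le0, symmetric] using w(1) by (simp add: unit_nonneg_vecs_iff)
  ultimately have "\<kappa> = 1"
    using vpos[of 0] by auto
  then show ?thesis
    using \<kappa> v(1) w(1) by (intro eq_vecI) (auto simp: unit_nonneg_vecs_iff less_Suc_eq_le)
qed

text \<open>For fixed \<open>l\<close>, forgetting the vector of a trio is injective, as each
  signature has at most one unit aligned vector.\<close>

lemma mult_eq:
  assumes l: "0 \<le> l"
  shows "lcp_aligned_mult (Suc p) M l = mult_at l"
proof -
  let ?T = "{(S, v). (l, S, v) \<in> lcp_aligned_trios (Suc p) M}"
  have "inj_on fst ?T"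
  proof (rule inj_onI, clarsimp)
    fix S v w
    assume t: "(l, S, v) \<in> lcp_aligned_trios (Suc p) M" "(l, S, w) \<in> lcp_aligned_trios (Suc p) M"
    from t(1) obtain J where J: "J \<subseteq> {..p}" "S = sign_matrix p J"
      by (rule trio_sign_matrix)
    show "v = w"
      using t trio_iff[OF J(1)] unfolding J(2) by (intro unit_eigenvector_unique[OF l J(1)]) auto
  qed
  then have "card ?T = card (fst ` ?T)"
    by (rule card_image[symmetric])
  also have "fst ` ?T = sign_matrix p ` {J. J \<subseteq> {..p} \<and> aligned p A l J}"
  proof (intro equalityI subsetI)
    fix S assume "S \<in> fst ` ?T"
    then obtain v where t: "(l, S, v) \<in> lcp_aligned_trios (Suc p) M" by auto
    then obtain J where J: "J \<subseteq> {..p}" "S = sign_matrix p J"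
      by (rule trio_sign_matrix)
    then show "S \<in> sign_matrix p ` {J. J \<subseteq> {..p} \<and> aligned p A l J}"
      using t trio_iff[OF J(1)] by (auto simp: aligned_iff_unit)
  next
    fix S assume "S \<in> sign_matrix p ` {J. J \<subseteq> {..p} \<and> aligned p A l J}"
    then obtain J v where J: "J \<subseteq> {..p}" "S = sign_matrix p J"
      and "v \<in> unit_nonneg_vecs (Suc p)" "signed_eigen p A l J (($) v)"
      by (auto simp: aligned_iff_unit)
    then have "(S, v) \<in> ?T"
      using l trio_iff[OF J(1)] by simp
    then show "S \<in> fst ` ?T" by force
  qed
  also have "card \<dots> = mult_at l"
    unfolding mult_at_def
    by (intro card_image inj_on_subset[OF inj_on_sign_matrix]) auto
  finally show ?thesis
    unfolding lcp_aligned_mult_def .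
qed

lemma count_eq: "lcp_aligned_count (Suc p) M = (\<Sum>x\<in>{x \<in> aligned_values. 1 < x}. mult_at x)"
  unfolding lcp_aligned_count_def spec_eq by (intro sum.cong) (auto simp: mult_eq)

text \<open>Lets a vanishing count be read as the absence of aligned values above 1.\<close>

lemma mult_at_pos:
  assumes "x \<in> aligned_values"
  shows "mult_at x > 0"
proof -
  have "finite {J. J \<subseteq> {..p} \<and> aligned p A x J}"
    by (rule finite_subset[of _ "Pow {..p}"]) auto
  then show ?thesis
    using assms by (auto simp: mult_at_def card_gt_0_iff aligned_values_def)
qed

text \<open>Because \<open>M - 1 = B A\<close>, the factor \<open>B\<close> comes out of both terms
  and leaves the member of the family at \<open>x = 1\<close>.\<close>

lemma G_map_eq:
  assumes z: "z \<in> carrier_vec (Suc p)"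
  shows "G_map (Suc p) M z = (1/2) \<cdot>\<^sub>v (B *\<^sub>v (z - A *\<^sub>v map_vec abs z))"
proof -
  have a: "map_vec abs z \<in> carrier_vec (Suc p)" using z by simp
  have "(M - 1\<^sub>m (Suc p)) *\<^sub>v map_vec abs z = B *\<^sub>v (A *\<^sub>v map_vec abs z)"
    unfolding minus_one_eq by (rule assoc_mult_mat_vec[OF B_carrier A_carrier a])
  moreover have Aa: "A *\<^sub>v map_vec abs z \<in> carrier_vec (Suc p)"
    by (rule mult_mat_vec_carrier[OF A_carrier a])
  moreover have "B *\<^sub>v (z - A *\<^sub>v map_vec abs z) = B *\<^sub>v z - B *\<^sub>v (A *\<^sub>v map_vec abs z)"
    by (rule mult_minus_distrib_mat_vec[OF B_carrier z Aa])
  moreover have "B *\<^sub>v u \<in> carrier_vec (Suc p)" if "u \<in> carrier_vec (Suc p)" for u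
    by (rule mult_mat_vec_carrier[OF B_carrier that])
  ultimately show ?thesis
    unfolding G_map_def using z by (intro eq_vecI) (auto simp: right_diff_distrib)
qed

abbreviation family_map :: "(nat \<Rightarrow> real) \<Rightarrow> nat \<Rightarrow> real" where
  "family_map \<equiv> plmap p (shifted A 1) (shifted A (- 1))"

lemma family_map_eq:
  assumes z: "z \<in> carrier_vec (Suc p)" and i: "i \<le> p"
  shows "(z - A *\<^sub>v map_vec abs z) $ i = family_map (($) z) i"
proof -
  have "map_vec abs z \<in> carrier_vec (Suc p)" using z by simp
  then have "(A *\<^sub>v map_vec abs z) $ i = (\<Sum>j\<le>p. A $$ (i, j) * \<bar>z $ j\<bar>)"
    using z i by (simp add: mult_mat_vec_index[OF A_carrier])
  then show ?thesis
    using z i A_carrier by (simp add: plmap_shifted)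
qed

lemma nondegenerate:
  assumes "1 \<notin> aligned_values"
  shows "G_nondegenerate (Suc p) M"
  unfolding G_nondegenerate_def
proof (intro ballI impI)
  fix z assume z: "z \<in> carrier_vec (Suc p)" and G: "G_map (Suc p) M z = 0\<^sub>v (Suc p)"
  let ?w = "z - A *\<^sub>v map_vec abs z"
  have w: "?w \<in> carrier_vec (Suc p)"
    using z A_carrier by simp
  have Bw: "B *\<^sub>v ?w \<in> carrier_vec (Suc p)"
    by (rule mult_mat_vec_carrier[OF B_carrier w])
  have "B *\<^sub>v ?w = 0\<^sub>v (Suc p)"
    using G Bw unfolding G_map_eq[OF z] by (auto simp: vec_eq_iff)
  also have "\<dots> = B *\<^sub>v 0\<^sub>v (Suc p)"
    using B_carrier by (intro eq_vecI) auto
  finally have "?w = 0\<^sub>v (Suc p)"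
    using B_cancel[OF w] by simp
  then have "family_map (($) z) i = 0" if "i \<le> p" for i
    using family_map_eq[OF z that] that by simp
  then have "\<forall>i\<le>p. z $ i = 0"
    using nondeg_not_aligned[OF assms] unfolding nondeg_def by blast
  then show "z = 0\<^sub>v (Suc p)"
    using z by (intro eq_vecI) (auto simp: less_Suc_eq_le)
qed

lemma degree_eq:
  assumes "1 \<notin> aligned_values"
  obtains e where "real_of_int e = sgn (det B)" "odd e" "deg_G (Suc p) M = e * shifted_degree 1"
proof -
  \<comment> \<open>Column \<open>k\<close> of \<open>cmat p C\<close> is \<open>C k\<close>, hence
    the exchanged indices. The factor 1/2 of \<open>G_map\<close> scales the determinant by a
    positive number.\<close>
  define C where "C k i = (1/2) * B $$ (i, k)" for k i
  have cC: "cmat p C = (1/2) \<cdot>\<^sub>m B"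
    using B_carrier by (intro eq_matI) (auto simp: cmat_def C_def)
  have dC: "det (cmat p C) = (1/2) ^ Suc p * det B"
    unfolding cC using B_carrier by (simp add: det_smult)
  then have dC0: "det (cmat p C) \<noteq> 0" unfolding dC using det_B by simp
  let ?P = "\<lambda>j i. \<Sum>k\<le>p. shifted A 1 j k * C k i" and ?Q = "\<lambda>j i. \<Sum>k\<le>p. shifted A (- 1) j k * C k i"
  have "G_sphere (Suc p) M x = normalize_to p (plmap p ?P ?Q x)" for x
  proof -
    let ?z = "vec (Suc p) x"
    let ?w = "?z - A *\<^sub>v map_vec abs ?z"
    have z: "?z \<in> carrier_vec (Suc p)" by simp
    have w: "?w \<in> carrier_vec (Suc p)" using A_carrier by simp
    have G: "G_map (Suc p) M ?z $ i = plmap p ?P ?Q x i" if i: "i \<le> p" for i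
    proof -
      have "G_map (Suc p) M ?z $ i = 1/2 * (\<Sum>k\<le>p. B $$ (i, k) * ?w $ k)"
        unfolding G_map_eq[OF z]
        using i B_carrier mult_mat_vec_index[OF B_carrier w i] by simp
      also have "\<dots> = (\<Sum>k\<le>p. family_map x k * C k i)"
        unfolding sum_distrib_left
      proof (rule sum.cong)
        fix k assume "k \<in> {..p}"
        then have k: "k \<le> p" by simp
        have "?w $ k = family_map (($) ?z) k"
          by (rule family_map_eq[OF z k])
        also have "\<dots> = family_map x k"
          by (simp add: plmap_def)
        finally show "1/2 * (B $$ (i, k) * ?w $ k) = family_map x k * C k i"
          by (simp add: C_def)
      qed simp
      also have "\<dots> = plmap p ?P ?Q x i"
        by (rule plmap_linear_image[symmetric])
      finally show ?thesis .
    qed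
    have dim: "dim_vec (G_map (Suc p) M ?z) = Suc p"
      unfolding G_map_eq[OF z] using B_carrier by simp
    have "G_sphere (Suc p) M x = normalize_to p (($) (G_map (Suc p) M ?z))"
      unfolding G_sphere_def Let_def fun_of_vec_def normalize_to_def vnorm2_def
      by (auto simp: dim fun_eq_iff less_Suc_eq_le lessThan_Suc_atMost)
    also have "\<dots> = normalize_to p (plmap p ?P ?Q x)"
      by (rule normalize_to_cong) (rule G)
    finally show ?thesis .
  qed
  then have "G_sphere (Suc p) M = (\<lambda>x. normalize_to p (plmap p ?P ?Q x))"
    by (rule ext)
  then have "deg_G (Suc p) M = pldeg p ?P ?Q"
    unfolding deg_G_def pldeg_def by simp
  also have "\<dots> = lindeg p C * shifted_degree 1"
    by (rule pldeg_linear_image[OF dC0 nondeg_not_aligned[OF assms]])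
  finally have "deg_G (Suc p) M = lindeg p C * shifted_degree 1" .
  moreover have "real_of_int (lindeg p C) = sgn (det B)"
    unfolding lindeg_eq_sgn_det[OF dC0] dC by (simp add: sgn_mult)
  ultimately show thesis
    using odd_lindeg[OF dC0] that by blast
qed

end

theorem theorem5p5:
  fixes n :: nat and M :: "real mat"
  assumes "1 \<le> n"
    and "M \<in> carrier_mat n n"
    and "lcp_generic n M"
    and "1 \<notin> lcp_aligned_spec n M"
  shows "G_nondegenerate n M
    \<and> [deg_G n M = 1 + int (lcp_aligned_count n M)] (mod 2)
    \<and> (lcp_aligned_count n M = 0 \<longrightarrow> real_of_int (deg_G n M) = sgn (det (M + 1\<^sub>m n)))
    \<and> ((\<forall>l \<in> lcp_aligned_spec n M. 1 < l) \<longrightarrow> deg_G n M = 0)"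
proof -
  obtain p where n: "n = Suc p"
    using assms(1) by (cases n) auto
  obtain N where "N \<in> carrier_mat n n" "inverts_mat (M + 1\<^sub>m n) N" "inverts_mat N (M + 1\<^sub>m n)"
    "generic_mat n (N * (M - 1\<^sub>m n))"
    using assms(3) by (auto simp: lcp_generic_def)
  then interpret lcp_generic_matrix p M N
    using assms(2) unfolding n by unfold_locales (auto simp: inverts_mat_def)
  have one: "1 \<notin> aligned_values"
    using assms(4) by (simp add: n spec_eq)
  obtain e where e: "real_of_int e = sgn (det B)" "odd e" "deg_G n M = e * shifted_degree 1"
    using degree_eq[OF one] unfolding n by blast
  have parity: "even (shifted_degree 1 - 1 - int (lcp_aligned_count n M))"
    using shifted_degree_parity[OF zero_le_one one] by (simp add: n count_eq)
  \<comment> \<open>The factor \<open>e\<close> is odd, so it preserves parity.\<close>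
  then have "even (deg_G n M - (1 + int (lcp_aligned_count n M)))"
    using e(2,3) by auto
  then have "[deg_G n M = 1 + int (lcp_aligned_count n M)] (mod 2)"
    by (simp add: cong_iff_dvd_diff)
  moreover have "real_of_int (deg_G n M) = sgn (det (M + 1\<^sub>m n))" if "lcp_aligned_count n M = 0"
  proof -
    have "\<forall>x\<in>{x \<in> aligned_values. 1 < x}. mult_at x = 0"
      using that finite_aligned_values unfolding n count_eq by simp
    then have "{1..} \<inter> aligned_values = {}"
      using one mult_at_pos by (force simp: order_le_less)
    then have "shifted_degree 1 = 1"
      by (intro shifted_degree_eq_1) simp_all
    then show ?thesis
      using e(1,3) by (simp add: n)
  qed
  moreover have "deg_G n M = 0" if "\<forall>l \<in> lcp_aligned_spec n M. 1 < l"
  proof -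
    \<comment> \<open>The spectrum consists of the nonnegative aligned values, so the family does
      not degenerate between the even map at \<open>x = 0\<close> and \<open>x = 1\<close>.\<close>
    have "{0..1} \<inter> aligned_values = {}"
      using that unfolding n spec_eq by force
    then have "shifted_degree 1 = 0"
      by (intro shifted_degree_eq_0) simp_all
    then show ?thesis
      using e(3) by simp
  qed
  ultimately show ?thesis
    using nondegenerate[OF one] by (simp add: n)
qed

end
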